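(* Let $\mu=\{\mu_k\}_{k=0}^\infty$ be a sequence of complex numbers, let $\gamma_k=\sum_{j=0}^{\lfloor k/2\rfloor}\binom{k}{j}\mu_{k-2j}$, and define the formal power series $T_\mu(e^z)=\sum_{k=0}^\infty\frac{\gamma_k}{k!}z^k$. The following are equivalent: (i) for all polynomials $P(z)$ with only real and non-positive zeros, the polynomial $T_\mu(P(z))$ is either identically zero or weakly Hurwitz stable; (ii) $T_\mu(e^z)\in\mathcal{H}(\mathbb{C})\cup\{0\}$; (iii) $T_\mu(\mathcal{LP}^+)\subseteq\mathcal{H}(\mathbb{C})\cup\{0\}$.
   Context: For a power series (or polynomial) $\phi(z)=\sum_k a_kz^k$, $T_\mu(\phi)=\sum_{m\ge0}\Big(\sum_{i\le j,\ i+j=m}\mu_{j-i}a_ia_j\Big)z^m$ (this is consistent with the formula $T_\mu(e^z)=\sum\gamma_kz^k/k!$). A polynomial $F$ is weakly Hurwitz stable if $F(z)\ne0$ whenever $\operatorname{Re}(z)>0$. $\mathcal{H}(\mathbb{C})$ is the set of entire functions that are limits, uniformly on compact subsets of $\mathbb{C}$, of univariate polynomials all of whose zeros lie in the closed left half-plane. The Laguerre–Pólya class $\mathcal{LP}$ is the set of entire functions that are limits, uniformly on compact subsets of $\mathbb{C}$, of real polynomials with only real zeros; $\mathcal{LP}^+$ is the set of functions in $\mathcal{LP}$ with non-negative Taylor coefficients (equivalently, functions $Cz^Me^{az}\prod_{j}(1+\rho_jz)$ with $a,C\ge0$, $M\in\mathbb{N}$, $\rho_j\ge0$, $\sum_j\rho_j<\infty$).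 *)

theory Defs
  imports "HOL-Complex_Analysis.Complex_Analysis"
begin

definition gamma_seq :: "(nat \<Rightarrow> complex) \<Rightarrow> nat \<Rightarrow> complex" where
  "gamma_seq \<mu> k = (\<Sum>j\<in>{0..k div 2}. of_nat (k choose j) * \<mu> (k - 2 * j))"

definition T_coeff :: "(nat \<Rightarrow> complex) \<Rightarrow> (nat \<Rightarrow> complex) \<Rightarrow> nat \<Rightarrow> complex" where
  "T_coeff \<mu> a m = (\<Sum>(i, j)\<in>{(i, j). i \<le> j \<and> i + j = m}. \<mu> (j - i) * a i * a j)"

definition T_fps :: "(nat \<Rightarrow> complex) \<Rightarrow> complex fps \<Rightarrow> complex fps" where
  "T_fps \<mu> F = Abs_fps (T_coeff \<mu> (fps_nth F))"

text \<open>\<^const>\<open>Abs_poly\<close> is only meaningful on sequences of finite support; lemma \<open>coeff_T_poly\<close>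
  below shows that this is the case here.\<close>
definition T_poly :: "(nat \<Rightarrow> complex) \<Rightarrow> complex poly \<Rightarrow> complex poly" where
  "T_poly \<mu> P = Abs_poly (T_coeff \<mu> (coeff P))"

definition T_exp :: "(nat \<Rightarrow> complex) \<Rightarrow> complex fps" where
  "T_exp \<mu> = Abs_fps (\<lambda>k. gamma_seq \<mu> k / fact k)"

definition weakly_Hurwitz_stable :: "complex poly \<Rightarrow> bool" where
  "weakly_Hurwitz_stable F \<longleftrightarrow> (\<forall>z. Re z > 0 \<longrightarrow> poly F z \<noteq> 0)"

definition locally_uniform_poly_limit :: "(nat \<Rightarrow> complex poly) \<Rightarrow> (complex \<Rightarrow> complex) \<Rightarrow> bool" where
  "locally_uniform_poly_limit p f \<longleftrightarrow>
     (\<forall>K. compact K \<longrightarrow> uniform_limit K (\<lambda>n. poly (p n)) f sequentially)"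

text \<open>The zero polynomial vanishes everywhere, so the conditions on zeros below exclude it as an
  approximant. The zero function is nevertheless a member of both \<open>Hurwitz_class\<close> and
  \<open>LP_class\<close>, being the limit of the constants \<open>1 / (n + 1)\<close>.\<close>
definition Hurwitz_class :: "(complex \<Rightarrow> complex) set" where
  "Hurwitz_class = {f. f holomorphic_on UNIV \<and>
     (\<exists>p. (\<forall>n z. poly (p n) z = 0 \<longrightarrow> Re z \<le> 0) \<and> locally_uniform_poly_limit p f)}"

definition LP_class :: "(complex \<Rightarrow> complex) set" where
  "LP_class = {f. f holomorphic_on UNIV \<and>
     (\<exists>p. (\<forall>n k. coeff (p n) k \<in> \<real>) \<and> (\<forall>n z. poly (p n) z = 0 \<longrightarrow> z \<in> \<real>) \<and>
          locally_uniform_poly_limit p f)}"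

definition LP_plus :: "(complex \<Rightarrow> complex) set" where
  "LP_plus = {f \<in> LP_class. \<forall>n. fps_nth (fps_expansion f 0) n \<in> \<real>\<^sub>\<ge>\<^sub>0}"

text \<open>Membership of a formal power series in a set of entire functions: the series converges on the
  whole plane and its sum belongs to the set. The radius condition is essential, since
  \<^const>\<open>eval_fps\<close> has unspecified values where the series diverges.\<close>
definition entire_fps :: "(complex \<Rightarrow> complex) set \<Rightarrow> complex fps set" where
  "entire_fps A = {F. fps_conv_radius F = \<infinity> \<and> eval_fps F \<in> A}"

lemma T_coeff_altdef:
  "T_coeff \<mu> a m = (\<Sum>i\<in>{0..m div 2}. \<mu> (m - 2 * i) * a i * a (m - i))"
  unfolding T_coeff_def
  by (rule sum.reindex_bij_witness[of _ "\<lambda>i. (i, m - i)" fst]) (auto simp: mult_2)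

lemma coeff_T_poly: "coeff (T_poly \<mu> P) = T_coeff \<mu> (coeff P)"
  unfolding T_poly_def
proof (rule coeff_Abs_poly)
  fix m assume "2 * degree P < m"
  then show "T_coeff \<mu> (coeff P) m = 0"
    unfolding T_coeff_altdef by (intro sum.neutral ballI) (auto simp: coeff_eq_0)
qed

lemma fps_of_poly_T_poly: "fps_of_poly (T_poly \<mu> P) = T_fps \<mu> (fps_of_poly P)"
  by (simp add: fps_eq_iff T_fps_def coeff_T_poly fps_of_poly_nth[abs_def])

lemma T_exp_eq: "T_exp \<mu> = T_fps \<mu> (fps_exp 1)"
  unfolding fps_eq_iff T_exp_def T_fps_def T_coeff_altdef gamma_seq_def
  by (auto simp: sum_divide_distrib binomial_fact intro!: sum.cong)

end

theory Submission
  imports Defs "HOL-Computational_Algebra.Fundamental_Theorem_Algebra"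
begin

text \<open>For \<open>P(x) = (\<Prod>i<m. s i + x)\<close>, the product \<open>P(z u) P(z / u)\<close> is a polynomial in
  \<open>u + 1/u\<close>, and this identifies \<open>T_poly \<mu> P\<close> at \<open>z\<close> with the image of
  \<open>\<Prod>i<m. (s i)\<^sup>2 + z\<^sup>2 + s i * z * w\<close> under the linear functional \<open>w^k \<mapsto> \<gamma>\<^sub>k\<close>.
  For \<open>Re z > 0\<close> that product has all its roots in \<open>Re w < 0\<close>. If \<open>T_exp \<mu>\<close> is a limit of
  Hurwitz stable polynomials \<open>p\<close>, the functional is the limit of \<open>g \<mapsto> (p(D) g)(0)\<close>, where \<open>D\<close> is
  differentiation, and each factor \<open>D - \<alpha>\<close> with \<open>Re \<alpha> \<le> 0\<close> preserves the location of the
  roots, as the logarithmic derivative shows. Hurwitz's theorem then gives (ii) \<open>\<Longrightarrow>\<close> (i).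
  Conversely, a function in \<open>LP_plus\<close> is the coefficientwise limit of its Jensen polynomials,
  which have only real non-positive zeros, and by an inequality of Szasz a coefficientwise limit of
  Hurwitz stable polynomials is locally uniform. This gives (i) \<open>\<Longrightarrow>\<close> (iii), and (ii) is
  the case \<open>exp\<close> of (iii).\<close>

section \<open>Constant-coefficient differential operators and half-planes\<close>

definition diff_op :: "complex poly \<Rightarrow> complex poly \<Rightarrow> complex poly" where
  "diff_op p q = (\<Sum>k\<le>degree p. smult (coeff p k) ((pderiv ^^ k) q))"

lemma diff_op_altdef:
  assumes "degree p \<le> N"
  shows "diff_op p q = (\<Sum>k\<le>N. smult (coeff p k) ((pderiv ^^ k) q))"
  unfolding diff_op_def using assms
  by (intro sum.mono_neutral_left) (auto simp: coeff_eq_0)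

lemma diff_op_1 [simp]: "diff_op 1 q = q"
  by (simp add: diff_op_def)

lemma diff_op_add: "diff_op (p + p') q = diff_op p q + diff_op p' q"
proof -
  let ?N = "max (degree p) (degree p')"
  have "degree (p + p') \<le> ?N" by (rule degree_add_le_max)
  then show ?thesis
    by (simp add: diff_op_altdef[where N = ?N] smult_add_left sum.distrib)
qed

lemma diff_op_smult: "diff_op (smult a p) q = smult a (diff_op p q)"
proof -
  have "diff_op (smult a p) q = (\<Sum>k\<le>degree p. smult a (smult (coeff p k) ((pderiv ^^ k) q)))"
    by (subst diff_op_altdef[where N = "degree p"]) auto
  then show ?thesis
    by (simp add: diff_op_def poly_eq_iff coeff_sum sum_distrib_left mult.assoc)
qed

lemma diff_op_pCons_0: "diff_op (pCons 0 p) q = pderiv (diff_op p q)"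
proof -
  have "diff_op (pCons 0 p) q = (\<Sum>k\<le>Suc (degree p). smult (coeff (pCons 0 p) k) ((pderiv ^^ k) q))"
    by (rule diff_op_altdef) (rule degree_pCons_le)
  also have "\<dots> = (\<Sum>k\<le>degree p. smult (coeff p k) (pderiv ((pderiv ^^ k) q)))"
    by (subst sum.atMost_Suc_shift) simp
  finally show ?thesis
    by (simp add: diff_op_def higher_pderiv_sum[of 1, simplified] pderiv_smult)
qed

lemma diff_op_linear_factor:
  "diff_op ([:- \<alpha>, 1:] * p) q = pderiv (diff_op p q) - smult \<alpha> (diff_op p q)"
proof -
  have "[:- \<alpha>, 1:] * p = pCons 0 p + smult (- \<alpha>) p"
    by (simp add: algebra_simps)
  then show ?thesis
    by (simp only: diff_op_add diff_op_smult diff_op_pCons_0) simp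
qed

lemma coeff_higher_pderiv_fact:
  "coeff ((pderiv ^^ k) q) m = fact (m + k) / fact m * coeff (q :: complex poly) (m + k)"
proof (induction k arbitrary: m)
  case (Suc k)
  have "coeff ((pderiv ^^ Suc k) q) m = of_nat (Suc m) * coeff ((pderiv ^^ k) q) (Suc m)"
    by (simp add: coeff_pderiv)
  also have "\<dots> = of_nat (Suc m) * (fact (Suc m + k) / fact (Suc m) * coeff q (Suc m + k))"
    by (simp only: Suc.IH)
  also have "\<dots> = fact (m + Suc k) / fact m * coeff q (m + Suc k)"
    by (simp add: fact_Suc[of m] del: of_nat_Suc fact_Suc)
  finally show ?case .
qed simp

text \<open>At 0 this is a symmetric pairing of coefficients, so a bound on either degree truncates
  the sum. With \<open>N\<close> bounding \<open>degree q\<close>, its length does not depend on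
  \<open>p\<close>, which allows limits in \<open>p\<close>.\<close>

lemma poly_diff_op_0:
  assumes "degree p \<le> N \<or> degree q \<le> N"
  shows "poly (diff_op p q) 0 = (\<Sum>k\<le>N. fact k * coeff p k * coeff q k)"
proof -
  let ?f = "\<lambda>k. fact k * coeff p k * coeff q k"
  have "poly (diff_op p q) 0 = sum ?f {..degree p}"
    by (simp add: diff_op_def poly_0_coeff_0 coeff_sum coeff_higher_pderiv_fact mult_ac)
  also have "\<dots> = sum ?f {..max (degree p) N}"
    by (intro sum.mono_neutral_left) (auto simp: coeff_eq_0)
  also have "\<dots> = sum ?f {..N}"
    using assms by (intro sum.mono_neutral_right) (auto simp: coeff_eq_0)
  finally show ?thesis .
qed

text \<open>The coefficients of \<open>diff_op p q\<close> form a triangular system in those of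
  \<open>p\<close>: the one of index \<open>degree q - k\<close> contains \<open>coeff p k\<close>
  times a nonzero multiple of \<open>lead_coeff q\<close>, and otherwise only
  \<open>coeff p i\<close> with \<open>i < k\<close>.\<close>

lemma diff_op_eq_0D:
  assumes "diff_op p q = 0" "q \<noteq> 0" "k \<le> degree q"
  shows "coeff p k = 0"
  using assms(3)
proof (induction k rule: less_induct)
  case (less k)
  let ?m = "degree q - k"
  let ?f = "\<lambda>i. coeff p i * (fact (?m + i) / fact ?m * coeff q (?m + i))"
  let ?N = "max (degree p) k"
  have "0 = coeff (diff_op p q) ?m" using assms(1) by simp
  also have "\<dots> = (\<Sum>i\<le>?N. ?f i)"
    by (subst diff_op_altdef[where N = ?N]) (simp_all add: coeff_sum coeff_higher_pderiv_fact)
  also have "\<dots> = (\<Sum>i\<in>{k}. ?f i)"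
  proof (rule sum.mono_neutral_right)
    show "\<forall>i\<in>{..?N} - {k}. ?f i = 0"
    proof
      fix i assume "i \<in> {..?N} - {k}"
      then consider "i < k" | "?m + i > degree q" using less.prems by fastforce
      then show "?f i = 0" by cases (use less in \<open>auto simp: coeff_eq_0\<close>)
    qed
  qed auto
  finally show ?case using less.prems assms(2) by simp
qed

lemma poly_pderiv_linear_factors:
  fixes r :: "nat \<Rightarrow> complex"
  assumes "\<And>i. i < n \<Longrightarrow> y \<noteq> r i"
  shows "poly (pderiv (\<Prod>i<n. [:- r i, 1:])) y
           = poly (\<Prod>i<n. [:- r i, 1:]) y * (\<Sum>i<n. 1 / (y - r i))"
  using assms
proof (induction n)
  case (Suc n)
  have *: "poly (pderiv (\<Prod>i<n. [:- r i, 1:])) y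
           = poly (\<Prod>i<n. [:- r i, 1:]) y * (\<Sum>i<n. 1 / (y - r i))"
    using Suc by simp
  have ne: "y - r n \<noteq> 0" using Suc.prems[of n] by simp
  have "poly (pderiv (\<Prod>i<Suc n. [:- r i, 1:])) y
      = poly (\<Prod>i<n. [:- r i, 1:]) y + poly (pderiv (\<Prod>i<n. [:- r i, 1:])) y * (y - r n)"
    by (simp only: prod.lessThan_Suc pderiv_mult) (simp add: pderiv_pCons algebra_simps)
  also have "\<dots> = poly (\<Prod>i<n. [:- r i, 1:]) y * (y - r n) * (\<Sum>i<Suc n. 1 / (y - r i))"
    using ne by (simp add: * field_simps)
  also have "\<dots> = poly (\<Prod>i<Suc n. [:- r i, 1:]) y * (\<Sum>i<Suc n. 1 / (y - r i))"
    by (simp only: prod.lessThan_Suc poly_mult) simp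
  finally show ?case .
qed simp

text \<open>The logarithmic derivative of \<open>q\<close> at \<open>y\<close> is a sum of numbers \<open>1 / (y - r)\<close>, each of
  which lies in the open half-plane \<open>Re (w / c) > 0\<close>, whereas \<open>\<alpha>\<close> does not.\<close>
lemma pderiv_minus_smult_halfplane:
  assumes roots: "\<And>z. poly q z = 0 \<Longrightarrow> Re (c * z) < b"
    and \<alpha>: "Re (\<alpha> / c) \<le> 0"
    and "pderiv q - smult \<alpha> q \<noteq> 0"
    and y: "Re (c * y) \<ge> b"
  shows "poly (pderiv q - smult \<alpha> q) y \<noteq> 0"
proof
  assume eq: "poly (pderiv q - smult \<alpha> q) y = 0"
  obtain r where r: "smult (lead_coeff q) (\<Prod>i<degree q. [:- r i, 1:]) = q"
    by (rule complex_poly_decompose')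
  define Q where "Q = (\<Prod>i<degree q. [:- r i, 1:])"
  have q: "q = smult (lead_coeff q) Q" using r by (simp add: Q_def)
  have qy: "poly q y \<noteq> 0" using roots y by force
  have root: "poly q (r i) = 0" if "i < degree q" for i
    by (subst q) (use that in \<open>auto simp: Q_def poly_prod\<close>)
  have ne: "y \<noteq> r i" if "i < degree q" for i
    using root[OF that] qy by auto
  have "poly (pderiv q) y = lead_coeff q * poly (pderiv Q) y"
    by (subst q) (simp add: pderiv_smult)
  also have "\<dots> = lead_coeff q * (poly Q y * (\<Sum>i<degree q. 1 / (y - r i)))"
    unfolding Q_def by (subst poly_pderiv_linear_factors) (use ne in auto)
  also have "\<dots> = poly q y * (\<Sum>i<degree q. 1 / (y - r i))"
    by (subst (4) q) simp
  finally have "\<alpha> = (\<Sum>i<degree q. 1 / (y - r i))"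
    using eq qy by (simp add: algebra_simps)
  then have "Re (\<alpha> / c) = (\<Sum>i<degree q. Re (1 / (c * (y - r i))))"
    by (simp add: sum_divide_distrib mult.commute)
  moreover have pos: "Re (1 / (c * (y - r i))) > 0" if "i < degree q" for i
  proof -
    have "Re (c * (y - r i)) > 0"
      using roots[OF root[OF that]] y by (simp add: algebra_simps)
    moreover from this have "c * (y - r i) \<noteq> 0" by force
    ultimately show ?thesis
      by (simp add: Re_divide' divide_pos_pos del: mult_eq_0_iff)
  qed
  \<comment> \<open>A nonempty sum of positive terms would contradict
    \<open>Re (\<alpha> / c) \<le> 0\<close>. For constant \<open>q\<close>, the polynomial in
    question is a constant with root \<open>y\<close>, hence zero.\<close>
  ultimately have "degree q = 0"
    using \<alpha> sum_pos[of "{..<degree q}" "\<lambda>i. Re (1 / (c * (y - r i)))"]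
    by (cases "degree q = 0") (auto simp: lessThan_empty_iff)
  then obtain a where "q = [:a:]" by (rule degree_eq_zeroE)
  then show False using eq \<open>pderiv q - smult \<alpha> q \<noteq> 0\<close> by simp
qed

text \<open>The linear factors of \<open>p\<close> act one after another. The rotation
  \<open>c\<close> covers both uses: \<open>c = 1\<close> for the left half-plane, and
  \<open>c = \<i>\<close> or \<open>c = - \<i>\<close> for real-rooted \<open>p\<close>, whose roots
  satisfy \<open>Re (z / c) = 0\<close>.\<close>

lemma diff_op_halfplane:
  assumes p: "\<And>z. poly p z = 0 \<Longrightarrow> Re (z / c) \<le> 0"
    and q: "\<And>z. poly q z = 0 \<Longrightarrow> Re (c * z) < b"
    and "diff_op p q \<noteq> 0"
    and y: "Re (c * y) \<ge> b"
  shows "poly (diff_op p q) y \<noteq> 0"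
proof -
  obtain r where r: "smult (lead_coeff p) (\<Prod>i<degree p. [:- r i, 1:]) = p"
    by (rule complex_poly_decompose')
  have "Re (r i / c) \<le> 0" if "i < degree p" for i
  proof (rule p)
    show "poly p (r i) = 0"
      by (subst r[symmetric]) (use that in \<open>auto simp: poly_prod\<close>)
  qed
  \<comment> \<open>Differentiation annihilates constants, so zero is carried along as an
    alternative; it persists under the remaining factors.\<close>
  then have main: "(\<forall>z. Re (c * z) \<ge> b \<longrightarrow> poly (diff_op (\<Prod>i<n. [:- r i, 1:]) q) z \<noteq> 0) \<or>
        diff_op (\<Prod>i<n. [:- r i, 1:]) q = 0" if "n \<le> degree p" for n
    using that
  proof (induction n)
    case 0
    then show ?case using q by force
  next
    case (Suc n)
    let ?R = "diff_op (\<Prod>i<n. [:- r i, 1:]) q"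
    have "diff_op (\<Prod>i<Suc n. [:- r i, 1:]) q = pderiv ?R - smult (r n) ?R"
      by (simp only: prod.lessThan_Suc mult.commute[of "prod _ _"] diff_op_linear_factor)
    moreover have "?R = 0 \<or> (\<forall>z. poly ?R z = 0 \<longrightarrow> Re (c * z) < b)"
      using Suc by force
    ultimately show ?case
      using pderiv_minus_smult_halfplane[of ?R c b "r n"] Suc.prems by fastforce
  qed
  have "diff_op p q = smult (lead_coeff p) (diff_op (\<Prod>i<degree p. [:- r i, 1:]) q)"
    by (subst r[symmetric]) (simp add: diff_op_smult)
  then show ?thesis using main[of "degree p"] assms(3) y by auto
qed

section \<open>The operator on products of linear factors\<close>

definition umbral_eval :: "(nat \<Rightarrow> complex) \<Rightarrow> complex poly \<Rightarrow> complex" where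
  "umbral_eval \<phi> p = (\<Sum>k\<le>degree p. \<phi> k * coeff p k)"

lemma umbral_eval_altdef:
  assumes "degree p \<le> N"
  shows "umbral_eval \<phi> p = (\<Sum>k\<le>N. \<phi> k * coeff p k)"
  unfolding umbral_eval_def using assms
  by (intro sum.mono_neutral_left) (auto simp: coeff_eq_0)

lemma umbral_eval_add: "umbral_eval \<phi> (p + q) = umbral_eval \<phi> p + umbral_eval \<phi> q"
proof -
  let ?N = "max (degree p) (degree q)"
  have "degree (p + q) \<le> ?N" by (rule degree_add_le_max)
  then show ?thesis
    by (simp add: umbral_eval_altdef[where N = ?N] distrib_left sum.distrib)
qed

lemma umbral_eval_smult: "umbral_eval \<phi> (smult a p) = a * umbral_eval \<phi> p"
  by (simp add: umbral_eval_altdef[where N = "degree p"] sum_distrib_left mult_ac)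

lemma umbral_eval_pCons_0: "umbral_eval \<phi> (pCons 0 p) = umbral_eval (\<lambda>k. \<phi> (Suc k)) p"
proof -
  have "umbral_eval \<phi> (pCons 0 p) = (\<Sum>k\<le>Suc (degree p). \<phi> k * coeff (pCons 0 p) k)"
    by (rule umbral_eval_altdef) (rule degree_pCons_le)
  also have "\<dots> = (\<Sum>k\<le>degree p. \<phi> (Suc k) * coeff p k)"
    by (subst sum.atMost_Suc_shift) simp
  finally show ?thesis by (simp add: umbral_eval_def)
qed

lemma umbral_eval_fun_add:
  "umbral_eval (\<lambda>k. \<phi> k + \<psi> k) p = umbral_eval \<phi> p + umbral_eval \<psi> p"
  by (simp add: umbral_eval_def distrib_right sum.distrib)

lemma umbral_eval_fun_cmult: "umbral_eval (\<lambda>k. c * \<phi> k) p = c * umbral_eval \<phi> p"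
  by (simp add: umbral_eval_def sum_distrib_left mult_ac)

lemma umbral_eval_linear_factor:
  "umbral_eval \<phi> ([:a, b:] * p) = a * umbral_eval \<phi> p + b * umbral_eval (\<lambda>k. \<phi> (Suc k)) p"
proof -
  have "[:a, b:] * p = smult a p + pCons 0 (smult b p)" by simp
  then show ?thesis
    by (simp only: umbral_eval_add umbral_eval_smult umbral_eval_pCons_0)
qed

text \<open>The functional \<open>u^d \<mapsto> \<nu> d\<close> on Laurent polynomials in
  \<open>u\<close>, applied to \<open>p(z / u) q(z u)\<close>. Keeping \<open>p\<close> and
  \<open>q\<close> apart allows linear factors to be removed from each separately.\<close>

definition conv_form :: "(int \<Rightarrow> complex) \<Rightarrow> complex \<Rightarrow> complex poly \<Rightarrow> complex poly \<Rightarrow> complex" where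
  "conv_form \<nu> z p q =
     umbral_eval (\<lambda>i. umbral_eval (\<lambda>j. \<nu> (int j - int i) * z ^ (i + j)) q) p"

text \<open>A factor \<open>s + x\<close> of \<open>p\<close> becomes \<open>s + z / u\<close>, and
  division by \<open>u\<close> shifts the offset by \<open>- 1\<close>; on the side of
  \<open>q\<close> it becomes \<open>s + z u\<close>, with the opposite shift.\<close>

lemma conv_form_linear_factor_left:
  "conv_form \<nu> z ([:s, 1:] * p) q
     = s * conv_form \<nu> z p q + z * conv_form (\<lambda>d. \<nu> (d - 1)) z p q"
proof -
  have "(\<lambda>j. \<nu> (int j - int (Suc i)) * z ^ (Suc i + j))
      = (\<lambda>j. z * (\<nu> (int j - int i - 1) * z ^ (i + j)))" for i
    by (auto simp: fun_eq_iff diff_diff_eq add.commute)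
  then show ?thesis
    by (simp only: conv_form_def umbral_eval_linear_factor umbral_eval_fun_cmult mult_1)
qed

lemma conv_form_linear_factor_right:
  "conv_form \<nu> z p ([:s, 1:] * q)
     = s * conv_form \<nu> z p q + z * conv_form (\<lambda>d. \<nu> (d + 1)) z p q"
proof -
  have "(\<lambda>j. \<nu> (int (Suc j) - int i) * z ^ (i + Suc j))
      = (\<lambda>j. z * (\<nu> (int j - int i + 1) * z ^ (i + j)))" for i
    by (auto simp: fun_eq_iff algebra_simps)
  then show ?thesis
    by (simp only: conv_form_def umbral_eval_linear_factor umbral_eval_fun_cmult
          umbral_eval_fun_add mult_1)
qed

lemma conv_form_fun_add:
  "conv_form (\<lambda>d. \<nu> d + \<nu>' d) z p q = conv_form \<nu> z p q + conv_form \<nu>' z p q"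
  by (simp add: conv_form_def distrib_right umbral_eval_fun_add)

text \<open>The value of the functional \<open>u^d \<mapsto> \<nu> d\<close> on Laurent polynomials at \<open>(u + 1/u)^k\<close>.\<close>
definition binomial_moment :: "(int \<Rightarrow> complex) \<Rightarrow> nat \<Rightarrow> complex" where
  "binomial_moment \<nu> k = (\<Sum>j\<le>k. of_nat (k choose j) * \<nu> (int k - 2 * int j))"

text \<open>One factor \<open>u + 1/u\<close> is absorbed into the functional; on the binomial sums
  this is Pascal's rule.\<close>

lemma binomial_moment_Suc:
  "binomial_moment \<nu> (Suc k) = binomial_moment (\<lambda>d. \<nu> (d - 1) + \<nu> (d + 1)) k"
proof -
  let ?f = "\<lambda>j. \<nu> (int (Suc k) - 2 * int j)"
  have "binomial_moment \<nu> (Suc k) =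
      ?f 0 + (\<Sum>j\<le>k. of_nat (Suc k choose Suc j) * ?f (Suc j))"
    unfolding binomial_moment_def by (subst sum.atMost_Suc_shift) simp
  also have "\<dots> = (\<Sum>j\<le>k. of_nat (k choose j) * ?f (Suc j)) +
      (?f 0 + (\<Sum>j\<le>k. of_nat (k choose Suc j) * ?f (Suc j)))"
    by (simp add: distrib_right sum.distrib)
  also have "?f 0 + (\<Sum>j\<le>k. of_nat (k choose Suc j) * ?f (Suc j))
      = (\<Sum>j\<le>Suc k. of_nat (k choose j) * ?f j)"
    by (subst sum.atMost_Suc_shift) simp
  also have "\<dots> = (\<Sum>j\<le>k. of_nat (k choose j) * ?f j)"
    by simp
  finally show ?thesis
    by (simp add: binomial_moment_def distrib_left sum.distrib algebra_simps)
qed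

text \<open>Both sides are the functional \<open>u^d \<mapsto> \<nu> d\<close> applied to
  \<open>P(z u) P(z / u) = (\<Prod>i<n. (s i)\<^sup>2 + z\<^sup>2 + s i * z * (u + 1/u))\<close>,
  where \<open>P(x) = (\<Prod>i<n. s i + x)\<close>.\<close>
lemma conv_form_linear_factors:
  fixes s :: "nat \<Rightarrow> complex"
  shows "conv_form \<nu> z (\<Prod>i<n. [:s i, 1:]) (\<Prod>i<n. [:s i, 1:])
     = umbral_eval (binomial_moment \<nu>) (\<Prod>i<n. [:(s i)\<^sup>2 + z\<^sup>2, s i * z:])"
proof (induction n arbitrary: \<nu>)
  case 0
  show ?case by (simp add: conv_form_def umbral_eval_def binomial_moment_def)
next
  case (Suc n)
  let ?P = "\<Prod>i<n. [:s i, 1:]" and ?G = "\<Prod>i<n. [:(s i)\<^sup>2 + z\<^sup>2, s i * z:]"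
  let ?\<nu> = "\<lambda>d. \<nu> (d - 1) + \<nu> (d + 1)"
  have "conv_form \<nu> z (\<Prod>i<Suc n. [:s i, 1:]) (\<Prod>i<Suc n. [:s i, 1:])
      = conv_form \<nu> z ([:s n, 1:] * ?P) ([:s n, 1:] * ?P)"
    by (simp only: prod.lessThan_Suc mult.commute)
  \<comment> \<open>The two opposite shifts together restore \<open>\<nu>\<close> and give the term
    \<open>z\<^sup>2\<close>; the single shifts give \<open>?\<nu>\<close>, which is why the
    induction varies the functional.\<close>
  also have "\<dots> = ((s n)\<^sup>2 + z\<^sup>2) * conv_form \<nu> z ?P ?P + s n * z * conv_form ?\<nu> z ?P ?P"
    by (simp add: conv_form_linear_factor_left conv_form_linear_factor_right conv_form_fun_add
        power2_eq_square algebra_simps del: mult_pCons_left)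
  also have "\<dots> = umbral_eval (binomial_moment \<nu>) ([:(s n)\<^sup>2 + z\<^sup>2, s n * z:] * ?G)"
    by (simp only: Suc.IH umbral_eval_linear_factor binomial_moment_Suc)
  finally show ?case
    by (simp only: prod.lessThan_Suc mult.commute)
qed

text \<open>The sum over \<open>i \<le> j\<close> becomes a sum over all \<open>i, j\<close> if the weight is
  distributed evenly to the offsets \<open>j - i\<close> and \<open>i - j\<close>.\<close>
definition even_weight :: "(nat \<Rightarrow> complex) \<Rightarrow> int \<Rightarrow> complex" where
  "even_weight \<mu> d = (if d = 0 then \<mu> 0 else \<mu> (nat \<bar>d\<bar>) / 2)"

lemma poly_T_poly: "poly (T_poly \<mu> P) z = conv_form (even_weight \<mu>) z P P"
proof -
  define N where "N = degree P"
  define a where "a = coeff P"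
  have a0: "a i = 0" if "i > N" for i
    using that by (simp add: a_def N_def coeff_eq_0)
  have deg: "degree (T_poly \<mu> P) \<le> 2 * N"
    by (rule degree_le) (auto simp: coeff_T_poly T_coeff_altdef a_def[symmetric] a0 intro!: sum.neutral)
  define h where "h = (\<lambda>(i, j). \<mu> (j - i) * a i * a j * z ^ (i + j))"
  define f where "f = (\<lambda>(i, j). even_weight \<mu> (int j - int i) * z ^ (i + j) * a j * a i)"
  \<comment> \<open>Off the diagonal, a pair in \<open>U\<close> and its swap each carry half of the
    weight of \<open>h\<close>; the diagonal \<open>D\<close> keeps its full weight.\<close>
  define U where "U = {(i, j). i < j \<and> j \<le> N}"
  define D where "D = (\<lambda>i. (i, i)) ` {..N}"
  have fin: "finite U" "finite D"
    by (rule finite_subset[of _ "{..N} \<times> {..N}"]) (auto simp: U_def D_def)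
  have "poly (T_poly \<mu> P) z = (\<Sum>m\<le>2 * N. T_coeff \<mu> a m * z ^ m)"
    using deg by (subst poly_altdef, intro sum.mono_neutral_cong_left)
      (auto simp: coeff_T_poly a_def intro!: le_degree)
  also have "\<dots> = (\<Sum>m\<le>2 * N. \<Sum>x\<in>{(i, j). i \<le> j \<and> i + j = m}. h x)"
    by (intro sum.cong refl, subst T_coeff_def, subst sum_distrib_right)
       (auto intro!: sum.cong simp: h_def)
  also have "\<dots> = sum h (\<Union>m\<le>2 * N. {(i, j). i \<le> j \<and> i + j = m})"
    by (rule sum.UNION_disjoint[symmetric])
      (auto intro: finite_subset[of _ "{..2*N} \<times> {..2*N}"])
  also have "\<dots> = sum h (U \<union> D)"
    by (intro sum.mono_neutral_right)
      (auto simp: U_def D_def h_def a0 image_iff intro: finite_subset[of _ "{..2*N} \<times> {..2*N}"])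
  also have "\<dots> = sum h U + sum h D"
    by (rule sum.union_disjoint) (use fin in \<open>auto simp: U_def D_def\<close>)
  also have "sum h D = sum f D"
    by (intro sum.cong) (auto simp: D_def h_def f_def even_weight_def)
  also have "sum h U = sum f U + sum f (prod.swap ` U)"
  proof -
    have "sum f (prod.swap ` U) = sum (f \<circ> prod.swap) U"
      by (rule sum.reindex) simp
    moreover have "h x = f x + (f \<circ> prod.swap) x" if "x \<in> U" for x
      using that by (auto simp: U_def h_def f_def even_weight_def nat_diff_distrib algebra_simps
          simp flip: of_nat_diff)
    ultimately show ?thesis by (simp add: sum.distrib)
  qed
  also have "sum f U + sum f (prod.swap ` U) + sum f D = sum f ({..N} \<times> {..N})"
  proof -
    have "{..N} \<times> {..N} = (U \<union> prod.swap ` U) \<union> D"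
      by (auto simp: U_def D_def image_iff)
    moreover have "U \<inter> prod.swap ` U = {}" "(U \<union> prod.swap ` U) \<inter> D = {}"
      by (auto simp: U_def D_def)
    ultimately show ?thesis
      using fin by (simp add: sum.union_disjoint)
  qed
  also have "\<dots> = conv_form (even_weight \<mu>) z P P"
    by (simp add: conv_form_def umbral_eval_def sum.cartesian_product f_def a_def N_def
        sum_distrib_right flip: sum.cartesian_product)
  finally show ?thesis .
qed

text \<open>The reflection \<open>j \<mapsto> k - j\<close> reverses the sign of the offset and
  fixes the binomial coefficient, so the two halves of each weight recombine; the midpoint set
  \<open>M\<close> is nonempty only for even \<open>k\<close>.\<close>

lemma binomial_moment_even_weight: "binomial_moment (even_weight \<mu>) k = gamma_seq \<mu> k"
proof -
  define h where "h = (\<lambda>j. of_nat (k choose j) * \<mu> (k - 2 * j))"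
  define f where "f = (\<lambda>j. of_nat (k choose j) * even_weight \<mu> (int k - 2 * int j))"
  define L where "L = {j. 2 * j < k}"
  define M where "M = {j. 2 * j = k}"
  have fin: "finite L" "finite M"
    by (rule finite_subset[of _ "{..k}"]; auto simp: L_def M_def)+
  have "gamma_seq \<mu> k = sum h (L \<union> M)"
    unfolding gamma_seq_def h_def by (intro sum.cong) (auto simp: L_def M_def)
  also have "\<dots> = sum h L + sum h M"
    by (rule sum.union_disjoint) (use fin in \<open>auto simp: L_def M_def\<close>)
  also have "sum h M = sum f M"
    by (intro sum.cong) (auto simp: M_def h_def f_def even_weight_def)
  also have "sum h L = sum f L + sum f ((\<lambda>j. k - j) ` L)"
  proof -
    have "sum f ((\<lambda>j. k - j) ` L) = sum (f \<circ> (\<lambda>j. k - j)) L"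
      by (rule sum.reindex) (auto simp: inj_on_def L_def)
    moreover have "h j = f j + (f \<circ> (\<lambda>j. k - j)) j" if "j \<in> L" for j
    proof -
      have "2 * j < k" "k choose (k - j) = k choose j"
        using that binomial_symmetric[of j k] by (auto simp: L_def)
      moreover have "nat \<bar>int k - 2 * int j\<bar> = k - 2 * j"
        "nat \<bar>int k - 2 * int (k - j)\<bar> = k - 2 * j"
        using \<open>2 * j < k\<close> by linarith+
      ultimately show ?thesis
        by (simp add: h_def f_def even_weight_def field_simps)
    qed
    ultimately show ?thesis by (simp add: sum.distrib)
  qed
  also have "sum f L + sum f ((\<lambda>j. k - j) ` L) + sum f M = sum f {..k}"
  proof -
    have "j \<in> (\<lambda>j. k - j) ` L" if "j \<le> k" "2 * j > k" for j
      by (rule image_eqI[of _ _ "k - j"]) (use that in \<open>auto simp: L_def\<close>)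
    then have "{..k} = (L \<union> (\<lambda>j. k - j) ` L) \<union> M"
      by (auto simp: L_def M_def) (meson linorder_neqE_nat)
    moreover have "L \<inter> (\<lambda>j. k - j) ` L = {}" "(L \<union> (\<lambda>j. k - j) ` L) \<inter> M = {}"
      by (auto simp: L_def M_def)
    ultimately show ?thesis
      using fin by (simp add: sum.union_disjoint)
  qed
  finally show ?thesis by (simp add: binomial_moment_def f_def)
qed

lemma T_poly_smult: "T_poly \<mu> (smult c P) = smult (c\<^sup>2) (T_poly \<mu> P)"
  by (rule poly_eqI)
    (simp add: coeff_T_poly T_coeff_altdef sum_distrib_left power2_eq_square mult_ac)

lemma poly_T_poly_linear_factors:
  fixes s :: "nat \<Rightarrow> complex"
  shows "poly (T_poly \<mu> (\<Prod>i<n. [:s i, 1:])) z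
     = umbral_eval (gamma_seq \<mu>) (\<Prod>i<n. [:(s i)\<^sup>2 + z\<^sup>2, s i * z:])"
  by (simp add: poly_T_poly conv_form_linear_factors binomial_moment_even_weight[abs_def])

section \<open>Limits of Hurwitz stable polynomials\<close>

text \<open>With finitely many fixed functions \<open>\<phi> k\<close>, convergence of the
  coefficients is locally uniform, so Hurwitz's theorem applies. The alternative in
  \<open>nz\<close> is the form of stability that passes to limits.\<close>

lemma Hurwitz_finite_sum:
  fixes \<phi> :: "nat \<Rightarrow> complex \<Rightarrow> complex"
  assumes S: "open S" "connected S"
    and holo: "\<And>k. \<phi> k holomorphic_on S"
    and lim: "\<And>k. (\<lambda>n. c n k) \<longlonglongrightarrow> c' k"
    and nz: "\<And>n. (\<forall>z\<in>S. (\<Sum>k\<le>N. c n k * \<phi> k z) \<noteq> 0) \<or> (\<forall>z\<in>S. (\<Sum>k\<le>N. c n k * \<phi> k z) = 0)"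
  shows "(\<forall>z\<in>S. (\<Sum>k\<le>N. c' k * \<phi> k z) \<noteq> 0) \<or> (\<forall>z\<in>S. (\<Sum>k\<le>N. c' k * \<phi> k z) = 0)"
proof (rule ccontr)
  define g where "g = (\<lambda>z. \<Sum>k\<le>N. c' k * \<phi> k z)"
  define h where "h = (\<lambda>n z. \<Sum>k\<le>N. c n k * \<phi> k z)"
  assume "\<not> ?thesis"
  then obtain z0 z1 where z0: "z0 \<in> S" "g z0 = 0" and z1: "z1 \<in> S" "g z1 \<noteq> 0"
    by (auto simp: g_def)
  \<comment> \<open>Nonvanishing at \<open>z1\<close> excludes the second alternative of
    \<open>nz\<close> for all large \<open>n\<close>; the shift by \<open>n0\<close> drops the other
    indices.\<close>
  have "(\<lambda>n. h n z1) \<longlonglongrightarrow> g z1"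
    unfolding h_def g_def by (intro tendsto_intros lim)
  then have "eventually (\<lambda>n. h n z1 \<noteq> 0) sequentially"
    using z1(2) by (rule tendsto_imp_eventually_ne)
  then obtain n0 where n0: "\<And>n. n \<ge> n0 \<Longrightarrow> h n z1 \<noteq> 0"
    by (auto simp: eventually_sequentially)
  have "g z0 \<noteq> 0"
  proof (rule Hurwitz_no_zeros[OF S, where \<F> = "\<lambda>n. h (n + n0)" and g = g and ?z0.0 = z0])
    show "h (n + n0) holomorphic_on S" for n
      unfolding h_def by (intro holomorphic_intros holo)
    show "g holomorphic_on S"
      unfolding g_def by (intro holomorphic_intros holo)
    show "\<not> g constant_on S"
      using z0 z1 by (metis constant_on_def)
    show "h (n + n0) z \<noteq> 0" if "z \<in> S" for n z
      using nz[of "n + n0"] n0[of "n + n0"] z1(1) that by (auto simp: h_def)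
    show "uniform_limit K (\<lambda>n. h (n + n0)) g sequentially" if K: "compact K" "K \<subseteq> S" for K
    proof -
      have "uniform_limit K (\<lambda>n z. c (n + n0) k * \<phi> k z) (\<lambda>z. c' k * \<phi> k z) sequentially" for k
      proof -
        have "(\<lambda>n. c (n + n0) k) \<longlonglongrightarrow> c' k"
          using lim by (rule LIMSEQ_ignore_initial_segment)
        then have "uniform_limit K (\<lambda>n _. c (n + n0) k) (\<lambda>_. c' k) sequentially"
          by (auto simp: uniform_limit_iff tendsto_iff elim: eventually_mono)
        moreover have "bounded (\<phi> k ` K)"
          using K holomorphic_on_imp_continuous_on[OF holo[of k]] compact_continuous_image
            compact_imp_bounded continuous_on_subset by metis
        moreover have "bounded ((\<lambda>_. c' k) ` K)"
          by (rule bounded_subset[of "{c' k}"]) auto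
        ultimately show ?thesis
          by (intro uniform_lim_mult uniform_limit_const)
      qed
      note tm = this
      have "uniform_limit K (\<lambda>n z. \<Sum>k\<le>m. c (n + n0) k * \<phi> k z)
          (\<lambda>z. \<Sum>k\<le>m. c' k * \<phi> k z) sequentially" for m
      proof (induction m)
        case 0
        show ?case using tm[of 0] by simp
      next
        case (Suc m)
        show ?case unfolding sum.atMost_Suc by (intro uniform_limit_add Suc tm)
      qed
      then show ?thesis by (simp add: h_def g_def)
    qed
  qed fact
  then show False using z0 by simp
qed

text \<open>The case \<open>\<alpha> = 0\<close> of \<open>pderiv_minus_smult_halfplane\<close>, a
  Gauss-Lucas argument. As roots may lie on the imaginary axis, the separating line is the vertical
  one through the evaluation point.\<close>

lemma weakly_Hurwitz_stable_higher_pderiv: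
  assumes "weakly_Hurwitz_stable p" "(pderiv ^^ m) p \<noteq> 0"
  shows "weakly_Hurwitz_stable ((pderiv ^^ m) p)"
  using assms(2)
proof (induction m)
  case (Suc m)
  let ?q = "(pderiv ^^ m) p"
  have "?q \<noteq> 0" using Suc.prems by auto
  then have st: "weakly_Hurwitz_stable ?q" by (rule Suc.IH)
  show ?case
    unfolding weakly_Hurwitz_stable_def
  proof (intro allI impI)
    fix z :: complex assume z: "Re z > 0"
    have "Re (1 * w) < Re z" if "poly ?q w = 0" for w
    proof -
      have "\<not> Re w > 0" using st that by (auto simp: weakly_Hurwitz_stable_def)
      then show ?thesis using z by simp
    qed
    from pderiv_minus_smult_halfplane[of ?q 1 "Re z" 0 z, OF this] Suc.prems
    show "poly ((pderiv ^^ Suc m) p) z \<noteq> 0" by simp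
  qed
qed (use assms in simp)

text \<open>Newton's identities for the first two power sums of the \<open>w i\<close>, whose
  elementary symmetric functions are the coefficients.\<close>

lemma coeff_unit_linear_factors:
  fixes w :: "nat \<Rightarrow> complex"
  defines "Q n \<equiv> \<Prod>i<n. [:1, w i:]"
  shows "coeff (Q n) 0 = 1" "coeff (Q n) 1 = (\<Sum>i<n. w i)"
    "(coeff (Q n) 1)\<^sup>2 - 2 * coeff (Q n) 2 = (\<Sum>i<n. (w i)\<^sup>2)"
proof -
  have step: "coeff (Q (Suc n)) k = coeff (Q n) k + w n * (if k = 0 then 0 else coeff (Q n) (k - 1))" for n k
    by (simp add: Q_def mult.commute[of "prod _ _"] coeff_pCons split: nat.splits)
  show 0: "coeff (Q n) 0 = 1" for n
    by (induction n) (simp_all add: step, simp add: Q_def)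
  have *: "coeff (Q n) 1 = (\<Sum>i<n. w i) \<and>
      (coeff (Q n) 1)\<^sup>2 - 2 * coeff (Q n) 2 = (\<Sum>i<n. (w i)\<^sup>2)"
  proof (induction n)
    case (Suc n)
    have "coeff (Q (Suc n)) 1 = coeff (Q n) 1 + w n"
      "coeff (Q (Suc n)) 2 = coeff (Q n) 2 + w n * coeff (Q n) 1"
      using step[of n 1] step[of n 2] 0 by (simp_all add: numeral_2_eq_2)
    note eqs = this
    have "(coeff (Q (Suc n)) 1)\<^sup>2 - 2 * coeff (Q (Suc n)) 2
        = (coeff (Q n) 1)\<^sup>2 - 2 * coeff (Q n) 2 + (w n)\<^sup>2"
      unfolding eqs by (simp add: algebra_simps power2_eq_square)
    with Suc.IH eqs(1) show ?case
      by (metis sum.lessThan_Suc)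
  qed (simp add: Q_def)
  then show "coeff (Q n) 1 = (\<Sum>i<n. w i)" by blast
  from * show "(coeff (Q n) 1)\<^sup>2 - 2 * coeff (Q n) 2 = (\<Sum>i<n. (w i)\<^sup>2)" by blast
qed

text \<open>Apply \<open>1 + x \<le> exp x\<close> to the squared modulus. Keeping
  \<open>Re u\<close> instead of \<open>norm u\<close> in the exponent matters: in a product, the
  linear terms add up to the real part of a single sum.\<close>

lemma norm_one_plus_le_exp:
  "norm (1 + u :: complex) \<le> exp (Re u + (norm u)\<^sup>2 / 2)"
proof (rule power2_le_imp_le)
  have "(norm (1 + u))\<^sup>2 = 1 + (2 * Re u + (norm u)\<^sup>2)"
    by (simp add: cmod_power2) (simp add: algebra_simps power2_eq_square)
  also have "\<dots> \<le> exp (2 * Re u + (norm u)\<^sup>2)" by (rule exp_ge_add_one_self)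
  also have "\<dots> = (exp (Re u + (norm u)\<^sup>2 / 2))\<^sup>2"
    by (simp add: power2_eq_square flip: exp_add)
  finally show "(norm (1 + u))\<^sup>2 \<le> (exp (Re u + (norm u)\<^sup>2 / 2))\<^sup>2" .
qed simp

text \<open>Szasz's inequality. For the negative inverse roots \<open>w i\<close>, which satisfy \<open>Re (w i) \<ge> 0\<close>, it
  rests on \<open>\<bar>w\<bar>\<^sup>2 = 2 (Re w)\<^sup>2 - Re (w\<^sup>2)\<close>, as \<open>\<Sum>i. w i\<close> and \<open>\<Sum>i. (w i)\<^sup>2\<close> are determined by
  the three lowest coefficients.\<close>
lemma weakly_Hurwitz_stable_bound:
  assumes "weakly_Hurwitz_stable p" "coeff p 0 \<noteq> 0"
  defines "s \<equiv> coeff p 1 / coeff p 0" and "t \<equiv> coeff p 2 / coeff p 0"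
  shows "norm (poly p z) \<le>
    norm (coeff p 0) * exp (norm s * norm z + (norm z)\<^sup>2 * (3 * (norm s)\<^sup>2 + 2 * norm t) / 2)"
proof -
  obtain r where r: "smult (lead_coeff p) (\<Prod>i<degree p. [:- r i, 1:]) = p"
    by (rule complex_poly_decompose')
  define n where "n = degree p"
  have root: "poly p (r i) = 0" if "i < n" for i
    by (subst r[symmetric]) (use that in \<open>auto simp: poly_prod n_def\<close>)
  have r0: "r i \<noteq> 0" if "i < n" for i
    using root[OF that] assms(2) by (auto simp: poly_0_coeff_0)
  have Re_r: "Re (r i) \<le> 0" if "i < n" for i
    using root[OF that] assms(1) by (force simp: weakly_Hurwitz_stable_def)
  define w where "w = (\<lambda>i. - 1 / r i)"
  have Re_w: "Re (w i) \<ge> 0" if "i < n" for i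
    using Re_r[OF that] by (simp add: w_def Re_divide' divide_nonpos_nonneg)
  define Q where "Q = (\<Prod>i<n. [:1, w i:])"
  have "(\<Prod>i<n. [:- r i, 1:]) = (\<Prod>i<n. smult (- r i) [:1, w i:])"
    by (intro prod.cong) (use r0 in \<open>auto simp: w_def\<close>)
  also have "\<dots> = smult (\<Prod>i<n. - r i) Q"
    by (simp only: prod_smult Q_def)
  finally have "p = smult (lead_coeff p * (\<Prod>i<n. - r i)) Q"
    using r by (simp add: n_def)
  then obtain a where p: "p = smult a Q" by blast
  have Q0: "coeff Q 0 = 1" and Q1: "coeff Q 1 = (\<Sum>i<n. w i)"
    and Q2: "(coeff Q 1)\<^sup>2 - 2 * coeff Q 2 = (\<Sum>i<n. (w i)\<^sup>2)"
    unfolding Q_def by (rule coeff_unit_linear_factors)+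
  have a: "a = coeff p 0" using Q0 by (simp add: p)
  then have s: "s = coeff Q 1" and t: "t = coeff Q 2"
    using assms(2) by (simp_all add: s_def t_def p)
  \<comment> \<open>All \<open>Re (w i)\<close> being nonnegative, each is at most their sum
    \<open>Re s\<close>.\<close>
  have "(\<Sum>i<n. (Re (w i))\<^sup>2) \<le> (\<Sum>i<n. Re (w i) * (\<Sum>j<n. Re (w j)))"
    unfolding power2_eq_square
    by (intro sum_mono mult_left_mono member_le_sum) (use Re_w in auto)
  also have "\<dots> = (Re s)\<^sup>2"
    by (simp add: s Q1 power2_eq_square del: One_nat_def flip: sum_distrib_right)
  also have "\<dots> \<le> (norm s)\<^sup>2"
    by (rule abs_le_square_iff[THEN iffD1]) (simp add: abs_Re_le_cmod)
  finally have 1: "(\<Sum>i<n. (Re (w i))\<^sup>2) \<le> (norm s)\<^sup>2" .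
  have "(\<Sum>i<n. (norm (w i))\<^sup>2) = (\<Sum>i<n. 2 * (Re (w i))\<^sup>2 - Re ((w i)\<^sup>2))"
    by (intro sum.cong) (auto simp: cmod_power2 Re_power2)
  also have "\<dots> = 2 * (\<Sum>i<n. (Re (w i))\<^sup>2) - Re (s\<^sup>2 - 2 * t)"
    by (simp only: s t Q2 Re_sum sum_subtractf sum_distrib_left)
  finally have 2: "(\<Sum>i<n. (norm (w i))\<^sup>2) = 2 * (\<Sum>i<n. (Re (w i))\<^sup>2) - Re (s\<^sup>2 - 2 * t)" .
  have "- Re (s\<^sup>2 - 2 * t) \<le> norm (s\<^sup>2 - 2 * t)"
    using abs_Re_le_cmod[of "s\<^sup>2 - 2 * t"] by linarith
  also have "\<dots> \<le> norm (s\<^sup>2) + norm (2 * t)" by (rule norm_triangle_ineq4)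
  finally have "- Re (s\<^sup>2 - 2 * t) \<le> (norm s)\<^sup>2 + 2 * norm t"
    by (simp add: norm_power norm_mult)
  with 1 2 have 3: "(\<Sum>i<n. (norm (w i))\<^sup>2) \<le> 3 * (norm s)\<^sup>2 + 2 * norm t"
    by linarith
  have sum_eq: "(\<Sum>i<n. Re (w i * z) + (norm (w i * z))\<^sup>2 / 2)
      = Re (s * z) + (norm z)\<^sup>2 * (\<Sum>i<n. (norm (w i))\<^sup>2) / 2"
    by (simp only: s Q1 sum.distrib sum_distrib_right Re_sum)
       (simp add: sum_distrib_left sum_divide_distrib norm_mult power_mult_distrib mult_ac)
  have "norm (poly Q z) = (\<Prod>i<n. norm (1 + w i * z))"
    by (simp add: Q_def poly_prod prod_norm mult.commute)
  also have "\<dots> \<le> (\<Prod>i<n. exp (Re (w i * z) + (norm (w i * z))\<^sup>2 / 2))"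
    by (intro prod_mono conjI norm_one_plus_le_exp norm_ge_zero)
  also have "\<dots> = exp (\<Sum>i<n. Re (w i * z) + (norm (w i * z))\<^sup>2 / 2)"
    by (simp only: exp_sum finite_lessThan)
  also have "\<dots> = exp (Re (s * z) + (norm z)\<^sup>2 * (\<Sum>i<n. (norm (w i))\<^sup>2) / 2)"
    by (simp only: sum_eq)
  also have "\<dots> \<le> exp (norm s * norm z + (norm z)\<^sup>2 * (3 * (norm s)\<^sup>2 + 2 * norm t) / 2)"
    using complex_Re_le_cmod[of "s * z"] 3
    by (auto simp: norm_mult intro!: add_mono mult_left_mono divide_right_mono)
  finally show ?thesis
    by (subst p) (simp add: norm_mult a mult_left_mono)
qed

section \<open>From coefficientwise to locally uniform convergence\<close>

lemma higher_deriv_poly: "(deriv ^^ k) (poly p) = poly ((pderiv ^^ k) p)"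
  for p :: "complex poly"
proof (induction k)
  case (Suc k)
  have "deriv (poly q) = poly (pderiv q)" for q :: "complex poly"
    by (rule ext) (rule DERIV_imp_deriv[OF poly_DERIV])
  then show ?case by (simp add: Suc)
qed simp

lemma fps_expansion_poly: "fps_nth (fps_expansion (poly p) 0) k = coeff p k"
  for p :: "complex poly"
  by (simp add: fps_expansion_def higher_deriv_poly poly_0_coeff_0 coeff_higher_pderiv_fact)

lemma coeff_Cauchy_bound:
  fixes p :: "complex poly"
  assumes "R > 0" "\<And>z. norm z = R \<Longrightarrow> norm (poly p z) \<le> B"
  shows "norm (coeff p k) * R ^ k \<le> B"
proof -
  have "norm ((deriv ^^ k) (poly p) 0) \<le> fact k * B / R ^ k"
    by (rule Cauchy_inequality) (use assms in \<open>auto intro!: holomorphic_intros continuous_intros\<close>)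
  moreover have "(deriv ^^ k) (poly p) 0 = fact k * coeff p k"
    by (simp add: higher_deriv_poly poly_0_coeff_0 coeff_higher_pderiv_fact)
  ultimately show ?thesis using assms(1)
    by (simp add: norm_mult field_simps mult_le_cancel_left)
qed

text \<open>Differentiating as often as the limit vanishes at 0 makes the constant coefficient stay
  away from 0, so that Szasz's inequality applies.\<close>
lemma weakly_Hurwitz_stable_coeff_bound:
  assumes st: "\<And>n. weakly_Hurwitz_stable (p n)"
    and lim: "\<And>k. (\<lambda>n. coeff (p n) k) \<longlonglongrightarrow> fps_nth F k"
    and "F \<noteq> 0" "R > 0"
  obtains C where "eventually (\<lambda>n. \<forall>k. norm (coeff (p n) k) * R ^ k \<le> C) sequentially"
proof -
  define M where "M = subdegree F"
  define d where "d n = (pderiv ^^ M) (p n)" for n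
  define a where "a j = fact (j + M) / fact j * fps_nth F (j + M)" for j
  have coeff_d: "coeff (d n) j = fact (j + M) / fact j * coeff (p n) (j + M)" for n j
    by (simp add: d_def coeff_higher_pderiv_fact)
  have lim_d: "(\<lambda>n. coeff (d n) j) \<longlonglongrightarrow> a j" for j
    unfolding coeff_d a_def by (intro tendsto_intros lim)
  have a0: "a 0 \<noteq> 0" using \<open>F \<noteq> 0\<close> by (simp add: a_def M_def)
  \<comment> \<open>Szasz's bound on the circle of radius \<open>R\<close>, as a function of the
    three lowest coefficients; it is continuous where \<open>x \<noteq> 0\<close>, and the
    \<open>+ 1\<close> in \<open>B\<close> leaves room for the approximants.\<close>
  define b where "b x y z = norm x * exp (norm (y / x) * R
      + R\<^sup>2 * (3 * (norm (y / x))\<^sup>2 + 2 * norm (z / x)) / 2)" for x y z :: complex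
  define B where "B = b (a 0) (a 1) (a 2) + 1"
  have "(\<lambda>n. b (coeff (d n) 0) (coeff (d n) 1) (coeff (d n) 2)) \<longlonglongrightarrow> b (a 0) (a 1) (a 2)"
    unfolding b_def by (intro tendsto_intros lim_d a0) auto
  then have "eventually (\<lambda>n. b (coeff (d n) 0) (coeff (d n) 1) (coeff (d n) 2) < B) sequentially"
    by (rule order_tendstoD) (simp add: B_def)
  moreover have "eventually (\<lambda>n. coeff (d n) 0 \<noteq> 0) sequentially"
    using lim_d a0 by (rule tendsto_imp_eventually_ne)
  \<comment> \<open>The coefficients below \<open>M\<close> are lost in \<open>d n\<close>, but they
    tend to 0.\<close>
  moreover have "eventually (\<lambda>n. \<forall>k\<in>{..<M}. norm (coeff (p n) k) < 1) sequentially"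
  proof (rule eventually_ball_finite, simp, rule ballI)
    fix k assume "k \<in> {..<M}"
    then have "k < subdegree F" by (simp add: M_def)
    then have "fps_nth F k = 0" by (rule nth_less_subdegree_zero)
    then have "(\<lambda>n. norm (coeff (p n) k)) \<longlonglongrightarrow> 0"
      using tendsto_norm[OF lim[of k]] by simp
    then show "eventually (\<lambda>n. norm (coeff (p n) k) < 1) sequentially"
      by (rule order_tendstoD) simp
  qed
  ultimately have "eventually (\<lambda>n. \<forall>k. norm (coeff (p n) k) * R ^ k \<le>
      B * R ^ M + (\<Sum>k<M. R ^ k)) sequentially"
  proof eventually_elim
    case (elim n)
    have "b x y z \<ge> 0" for x y z by (simp add: b_def)
    then have "0 \<le> B" by (simp add: B_def add_nonneg_nonneg)
    have pos: "(\<Sum>k<M. R ^ k) \<ge> 0" using \<open>R > 0\<close> by (intro sum_nonneg) auto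
    have "d n \<noteq> 0" using elim(2) by auto
    then have st_d: "weakly_Hurwitz_stable (d n)"
      unfolding d_def by (intro weakly_Hurwitz_stable_higher_pderiv st)
    have "norm (poly (d n) z) \<le> B" if "norm z = R" for z
      using weakly_Hurwitz_stable_bound[OF st_d elim(2), of z] elim(1) that
      by (simp add: b_def)
    then have d: "norm (coeff (d n) j) * R ^ j \<le> B" for j
      using \<open>R > 0\<close> by (intro coeff_Cauchy_bound) auto
    show ?case
    proof
      fix k
      show "norm (coeff (p n) k) * R ^ k \<le> B * R ^ M + (\<Sum>k<M. R ^ k)"
      proof (cases "k < M")
        case True
        then have "norm (coeff (p n) k) * R ^ k \<le> 1 * R ^ k"
          using elim(3) \<open>R > 0\<close> by (intro mult_right_mono) (auto intro: less_imp_le)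
        also have "\<dots> \<le> (\<Sum>k<M. R ^ k)"
          using True \<open>R > 0\<close> by (simp add: member_le_sum)
        finally show ?thesis using \<open>0 \<le> B\<close> \<open>R > 0\<close> by (simp add: add_increasing)
      next
        case False
        define j where "j = k - M"
        have k: "k = j + M" using False by (simp add: j_def)
        have "norm (coeff (p n) k) = 1 * norm (coeff (p n) (j + M))" by (simp add: k)
        \<comment> \<open>Differentiation multiplies coefficients by factors of at least 1, so
          bounds on \<open>d n\<close> carry back to \<open>p n\<close>.\<close>
        also have "\<dots> \<le> fact (j + M) / fact j * norm (coeff (p n) (j + M))"
          by (intro mult_right_mono) (auto simp: fact_mono)
        also have "\<dots> = norm (coeff (d n) j)"
          by (simp add: coeff_d norm_mult norm_divide)
        finally have "norm (coeff (p n) k) * R ^ k \<le> (norm (coeff (d n) j) * R ^ j) * R ^ M"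
          using \<open>R > 0\<close> by (simp add: k power_add mult_right_mono)
        also have "\<dots> \<le> B * R ^ M"
          using d[of j] \<open>R > 0\<close> by (intro mult_right_mono) auto
        finally show ?thesis using pos by linarith
      qed
    qed
  qed
  then show thesis by (rule that)
qed

text \<open>The bound at radius \<open>2 * r\<close> yields a geometric majorant at radius
  \<open>r\<close>, uniform in large \<open>n\<close> and inherited by \<open>F\<close>; convergence
  on discs is then dominated convergence for series.\<close>

lemma weakly_Hurwitz_stable_coeff_limit:
  assumes st: "\<And>n. weakly_Hurwitz_stable (p n)"
    and lim: "\<And>k. (\<lambda>n. coeff (p n) k) \<longlonglongrightarrow> fps_nth F k"
    and "F \<noteq> 0"
  shows "fps_conv_radius F = \<infinity>" "locally_uniform_poly_limit p (eval_fps F)"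
proof -
  have bound: "\<exists>C. (\<forall>k. norm (fps_nth F k) * r ^ k \<le> C * (1 / 2) ^ k) \<and>
      eventually (\<lambda>n. \<forall>k. norm (coeff (p n) k) * r ^ k \<le> C * (1 / 2) ^ k) sequentially"
    if "r > 0" for r :: real
  proof -
    obtain C where C: "eventually (\<lambda>n. \<forall>k. norm (coeff (p n) k) * (2 * r) ^ k \<le> C) sequentially"
      using weakly_Hurwitz_stable_coeff_bound[of p F "2 * r"] st lim \<open>F \<noteq> 0\<close> \<open>r > 0\<close> by auto
    have eq: "x * r ^ k \<le> C * (1 / 2) ^ k \<longleftrightarrow> x * (2 * r) ^ k \<le> C" for x k
      by (simp add: field_simps power_mult_distrib)
    have "norm (fps_nth F k) * (2 * r) ^ k \<le> C" for k
    proof (rule tendsto_upperbound)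
      show "(\<lambda>n. norm (coeff (p n) k) * (2 * r) ^ k) \<longlonglongrightarrow> norm (fps_nth F k) * (2 * r) ^ k"
        by (intro tendsto_intros lim)
      show "eventually (\<lambda>n. norm (coeff (p n) k) * (2 * r) ^ k \<le> C) sequentially"
        using C by eventually_elim blast
    qed simp
    with C show ?thesis by (intro exI[of _ C], unfold eq) blast
  qed
  have geom: "summable (\<lambda>k. C * (1 / 2) ^ k)" for C :: real
    by (intro summable_mult summable_geometric) simp
  have summ: "summable (\<lambda>k. fps_nth F k * z ^ k)" for z
  proof -
    obtain C where C: "\<And>k. norm (fps_nth F k) * (norm z + 1) ^ k \<le> C * (1 / 2) ^ k"
      using bound[of "norm z + 1"] by (auto simp: add_nonneg_pos)
    have "norm (fps_nth F k * z ^ k) \<le> C * (1 / 2) ^ k" for k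
    proof -
      have "norm (fps_nth F k * z ^ k) \<le> norm (fps_nth F k) * (norm z + 1) ^ k"
        by (auto simp: norm_mult norm_power intro!: mult_left_mono power_mono)
      with C[of k] show ?thesis by linarith
    qed
    then show ?thesis by (intro summable_comparison_test'[OF geom[of C], of 0]) auto
  qed
  then show rad: "fps_conv_radius F = \<infinity>"
    unfolding fps_conv_radius_def by (intro conv_radius_inftyI'')
  show "locally_uniform_poly_limit p (eval_fps F)"
    unfolding locally_uniform_poly_limit_def
  proof (intro allI impI)
    fix K :: "complex set" assume "compact K"
    then obtain r where r: "r > 0" "\<And>z. z \<in> K \<Longrightarrow> norm z \<le> r"
      using compact_imp_bounded by (force simp: bounded_pos)
    obtain C where C: "\<And>k. norm (fps_nth F k) * r ^ k \<le> C * (1 / 2) ^ k"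
      "eventually (\<lambda>n. \<forall>k. norm (coeff (p n) k) * r ^ k \<le> C * (1 / 2) ^ k) sequentially"
      using bound[OF r(1)] by blast
    \<comment> \<open>This majorizes the distance between \<open>poly (p n)\<close> and
      \<open>eval_fps F\<close> on the whole disc of radius \<open>r\<close>; it tends to 0 by
      Tannery's theorem.\<close>
    define e where "e n = (\<Sum>k. norm (coeff (p n) k - fps_nth F k) * r ^ k)" for n
    have term_le: "norm (norm (coeff (p n) k - fps_nth F k) * r ^ k) \<le> 2 * C * (1 / 2) ^ k"
      if "norm (coeff (p n) k) * r ^ k \<le> C * (1 / 2) ^ k" for n k
    proof -
      have "norm (coeff (p n) k - fps_nth F k) * r ^ k
          \<le> (norm (coeff (p n) k) + norm (fps_nth F k)) * r ^ k"
        using r(1) by (intro mult_right_mono norm_triangle_ineq4) auto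
      also have "\<dots> \<le> 2 * C * (1 / 2) ^ k"
        using that C(1)[of k] by (simp add: distrib_right)
      finally show ?thesis using r(1) by simp
    qed
    have "eventually (\<lambda>n. summable (\<lambda>k. norm (norm (coeff (p n) k - fps_nth F k) * r ^ k))) sequentially
        \<and> summable (\<lambda>n. norm (0 :: real)) \<and> (\<lambda>n. e n) \<longlonglongrightarrow> suminf (\<lambda>_. 0)"
      unfolding e_def
    proof (rule tannerys_theorem)
      show "(\<lambda>n. norm (coeff (p n) k - fps_nth F k) * r ^ k) \<longlonglongrightarrow> 0" for k
        using lim[of k] by (intro tendsto_mult_left_zero tendsto_norm_zero) (simp add: LIM_zero)
      have "eventually (\<lambda>x. True \<and> (\<forall>k. norm (coeff (p (snd x)) k) * r ^ k \<le> C * (1 / 2) ^ k))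
          (sequentially \<times>\<^sub>F sequentially)"
        by (rule eventually_prodI) (use C(2) in auto)
      then show "eventually (\<lambda>(k, n). norm (norm (coeff (p n) k - fps_nth F k) * r ^ k)
          \<le> 2 * C * (1 / 2) ^ k) (sequentially \<times>\<^sub>F sequentially)"
        by eventually_elim (use term_le in auto)
      show "summable (\<lambda>k. 2 * C * (1 / 2) ^ k)" by (rule geom)
    qed simp
    then have e: "e \<longlonglongrightarrow> 0" by simp
    show "uniform_limit K (\<lambda>n. poly (p n)) (eval_fps F) sequentially"
      unfolding uniform_limit_iff
    proof (intro allI impI)
      fix \<epsilon> :: real assume "\<epsilon> > 0"
      with e have "eventually (\<lambda>n. e n < \<epsilon>) sequentially"
        by (rule order_tendstoD)
      with C(2) show "eventually (\<lambda>n. \<forall>z\<in>K. dist (poly (p n) z) (eval_fps F z) < \<epsilon>) sequentially"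
      proof eventually_elim
        case (elim n)
        show ?case
        proof
          fix z assume "z \<in> K"
          let ?f = "\<lambda>k. (coeff (p n) k - fps_nth F k) * z ^ k"
          have *: "norm (?f k) \<le> norm (coeff (p n) k - fps_nth F k) * r ^ k" for k
            using r(2)[OF \<open>z \<in> K\<close>]
            by (auto simp: norm_mult norm_power intro!: mult_left_mono power_mono)
          have s: "summable (\<lambda>k. norm (coeff (p n) k - fps_nth F k) * r ^ k)"
            by (rule summable_comparison_test'[OF geom[of "2 * C"], of 0])
               (use term_le[of n] elim(1) in auto)
          have "(\<lambda>k. coeff (p n) k * z ^ k) sums (\<Sum>k\<le>degree (p n). coeff (p n) k * z ^ k)"
            by (rule sums_finite) (auto simp: coeff_eq_0)
          moreover have "(\<lambda>k. fps_nth F k * z ^ k) sums eval_fps F z"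
            unfolding eval_fps_def using summ by (rule summable_sums)
          ultimately have "?f sums (poly (p n) z - eval_fps F z)"
            by (auto simp: poly_altdef left_diff_distrib intro: sums_diff)
          then have "dist (poly (p n) z) (eval_fps F z) = norm (\<Sum>k. ?f k)"
            by (simp add: dist_norm sums_iff)
          also have "\<dots> \<le> e n"
            unfolding e_def using * s by (rule norm_suminf_le)
          finally show "dist (poly (p n) z) (eval_fps F z) < \<epsilon>" using elim(2) by linarith
        qed
      qed
    qed
  qed
qed

text \<open>Zero approximants can be discarded: if \<open>F \<noteq> 0\<close>, some coefficient of
  \<open>F\<close> is nonzero, so the \<open>p n\<close> are nonzero from some index on.\<close>

lemma entire_fps_Hurwitz_coeff_limit:
  assumes st: "\<And>n. p n = 0 \<or> weakly_Hurwitz_stable (p n)"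
    and lim: "\<And>k. (\<lambda>n. coeff (p n) k) \<longlonglongrightarrow> fps_nth F k"
  shows "F \<in> entire_fps (Hurwitz_class \<union> {\<lambda>_. 0})"
proof (cases "F = 0")
  case True
  then show ?thesis by (auto simp: entire_fps_def eval_fps_def)
next
  case False
  then obtain k where k: "fps_nth F k \<noteq> 0" by (auto simp: fps_eq_iff)
  then have "eventually (\<lambda>n. coeff (p n) k \<noteq> 0) sequentially"
    by (rule tendsto_imp_eventually_ne[OF lim])
  then obtain n0 where n0: "\<And>n. n \<ge> n0 \<Longrightarrow> coeff (p n) k \<noteq> 0"
    by (auto simp: eventually_sequentially)
  define q where "q n = p (n + n0)" for n
  have st_q: "weakly_Hurwitz_stable (q n)" for n
    using st[of "n + n0"] n0[of "n + n0"] by (auto simp: q_def)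
  have lim_q: "(\<lambda>n. coeff (q n) k) \<longlonglongrightarrow> fps_nth F k" for k
    unfolding q_def using lim by (rule LIMSEQ_ignore_initial_segment)
  note * = weakly_Hurwitz_stable_coeff_limit[of q F, OF st_q lim_q False]
  have "eval_fps F holomorphic_on UNIV"
    using *(1) by (intro holomorphic_on_eval_fps) auto
  moreover have "Re z \<le> 0" if "poly (q n) z = 0" for n z
    using st_q[of n] that by (force simp: weakly_Hurwitz_stable_def)
  ultimately show ?thesis
    using * by (auto simp: entire_fps_def Hurwitz_class_def)
qed

text \<open>Locally uniform convergence passes to all derivatives at 0; this turns the approximants
  in \<open>Hurwitz_class\<close> and \<open>LP_class\<close> into coefficient limits.\<close>

lemma coeff_tendsto_fps_expansion:
  assumes "locally_uniform_poly_limit p f"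
  shows "(\<lambda>n. coeff (p n) k) \<longlonglongrightarrow> fps_nth (fps_expansion f 0) k"
proof -
  have "uniform_limit (cball 0 1) (\<lambda>n. poly (p n)) f sequentially"
    using assms by (auto simp: locally_uniform_poly_limit_def)
  then have "uniform_limit (ball 0 1) (\<lambda>n. poly (p n)) f sequentially"
    by (rule uniform_limit_on_subset) auto
  then have "(\<lambda>n. (deriv ^^ k) (poly (p n)) 0) \<longlonglongrightarrow> (deriv ^^ k) f 0"
    by (rule higher_deriv_complex_uniform_limit) (auto intro!: always_eventually holomorphic_intros)
  then have "(\<lambda>n. (deriv ^^ k) (poly (p n)) 0 / fact k) \<longlonglongrightarrow> (deriv ^^ k) f 0 / fact k"
    by (intro tendsto_intros) auto
  then show ?thesis
    unfolding fps_expansion_poly[symmetric] by (simp add: fps_expansion_def)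
qed

section \<open>The equivalence\<close>

lemma coeff_holomorphic_linear_factors:
  fixes \<alpha> \<beta> :: "nat \<Rightarrow> complex \<Rightarrow> complex"
  assumes "\<And>i. \<alpha> i holomorphic_on S" "\<And>i. \<beta> i holomorphic_on S"
  shows "(\<lambda>z. coeff (\<Prod>i<n. [:\<alpha> i z, \<beta> i z:]) k) holomorphic_on S"
proof (induction n arbitrary: k)
  case 0
  then show ?case by simp
next
  case (Suc n)
  have "(\<lambda>z. coeff (\<Prod>i<Suc n. [:\<alpha> i z, \<beta> i z:]) k) =
      (\<lambda>z. \<alpha> n z * coeff (\<Prod>i<n. [:\<alpha> i z, \<beta> i z:]) k +
        \<beta> n z * (if k = 0 then 0 else coeff (\<Prod>i<n. [:\<alpha> i z, \<beta> i z:]) (k - 1)))"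
    by (auto simp: fun_eq_iff mult.commute[of "prod _ _"] coeff_pCons split: nat.splits)
  moreover have "\<dots> holomorphic_on S"
    using Suc by (cases "k = 0") (auto intro!: holomorphic_intros assms)
  ultimately show ?case by (simp only:)
qed

lemma poly_eq_0_if_zero_on_open:
  fixes p :: "complex poly"
  assumes "open S" "z \<in> S" "\<And>z. z \<in> S \<Longrightarrow> poly p z = 0"
  shows "p = 0"
proof (rule ccontr)
  assume "p \<noteq> 0"
  then have "finite {z. poly p z = 0}" by (rule poly_roots_finite)
  then have "finite S" by (rule rev_finite_subset) (use assms in auto)
  with assms show False using finite_imp_not_open by blast
qed

lemma open_connected_halfplane:
  assumes "c \<noteq> (0 :: complex)"
  shows "open {z. Re (c * z) > 0}" "connected {z. Re (c * z) > 0}" "1 / c \<in> {z. Re (c * z) > 0}"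
proof -
  have eq: "{z. Re (c * z) > 0} = {z. inner (cnj c) z > 0}"
    by (simp add: inner_complex_def)
  have "Re (c * (1 / c)) = 1" using assms by simp
  then show "1 / c \<in> {z. Re (c * z) > 0}" by (simp only: mem_Collect_eq zero_less_one)
  show "open {z. Re (c * z) > 0}"
    unfolding eq by (rule open_halfspace_gt)
  show "connected {z. Re (c * z) > 0}"
    unfolding eq by (intro convex_connected convex_halfspace_gt)
qed

lemma nonpos_root_factors:
  assumes "\<And>z. poly P z = 0 \<Longrightarrow> z \<in> \<real>\<^sub>\<le>\<^sub>0"
  obtains c n and s :: "nat \<Rightarrow> real" where "P = smult c (\<Prod>i<n. [:complex_of_real (s i), 1:])"
    "\<And>i. i < n \<Longrightarrow> s i \<ge> 0"
proof -
  obtain r where r: "smult (lead_coeff P) (\<Prod>i<degree P. [:- r i, 1:]) = P"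
    by (rule complex_poly_decompose')
  have "r i \<in> \<real>\<^sub>\<le>\<^sub>0" if "i < degree P" for i
  proof (rule assms)
    show "poly P (r i) = 0"
      by (subst r[symmetric]) (use that in \<open>auto simp: poly_prod\<close>)
  qed
  then have s: "- r i = complex_of_real (- Re (r i))" "- Re (r i) \<ge> 0" if "i < degree P" for i
    using that by (auto simp: complex_nonpos_Reals_iff complex_eq_iff)
  show thesis
  proof (rule that[of "lead_coeff P" "\<lambda>i. - Re (r i)" "degree P"])
    have "(\<Prod>i<degree P. [:- r i, 1:]) = (\<Prod>i<degree P. [:complex_of_real (- Re (r i)), 1:])"
      by (intro prod.cong refl) (use s(1) in auto)
    then show "P = smult (lead_coeff P) (\<Prod>i<degree P. [:complex_of_real (- Re (r i)), 1:])"
      using r by simp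
  qed (use s(2) in auto)
qed

text \<open>For \<open>Re z > 0\<close> the polynomial \<open>G z\<close> below has its roots \<open>- (s/z + z/s)\<close> in the open left
  half-plane, and the approximants of \<open>poly (T_poly \<mu> P) z\<close> are \<open>p n\<close>, as a differential
  operator, applied to \<open>G z\<close> at 0.\<close>
lemma T_poly_linear_factors_stable:
  fixes s :: "nat \<Rightarrow> real"
  assumes p: "\<And>n z. poly (p n) z = 0 \<Longrightarrow> Re z \<le> 0"
    and lim: "\<And>k. (\<lambda>n. fact k * coeff (p n) k) \<longlonglongrightarrow> gamma_seq \<mu> k"
    and s: "\<And>i. i < m \<Longrightarrow> s i \<ge> 0"
  defines "P \<equiv> \<Prod>i<m. [:complex_of_real (s i), 1:]"
  shows "T_poly \<mu> P = 0 \<or> weakly_Hurwitz_stable (T_poly \<mu> P)"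
proof -
  define H :: "complex set" where "H = {z. Re z > 0}"
  have H: "open H" "connected H" "1 \<in> H"
    using open_connected_halfplane[of 1] by (simp_all add: H_def)
  define G where "G z = (\<Prod>i<m. [:(of_real (s i))\<^sup>2 + z\<^sup>2, of_real (s i) * z:])" for z :: complex
  have deg_le: "degree (G z) \<le> m" for z
  proof -
    have "degree (G z) \<le> sum (degree \<circ> (\<lambda>i. [:(of_real (s i))\<^sup>2 + z\<^sup>2, of_real (s i) * z:])) {..<m}"
      unfolding G_def by (rule degree_prod_sum_le) simp
    also have "\<dots> \<le> (\<Sum>i<m. 1)" by (intro sum_mono) simp
    finally show ?thesis by simp
  qed
  have factor_ne: "[:(of_real (s i))\<^sup>2 + z\<^sup>2, of_real (s i) * z:] \<noteq> 0"
    and factor_root: "w * (of_real (s i) * z) + ((of_real (s i))\<^sup>2 + z\<^sup>2) = 0 \<Longrightarrow> Re w < 0"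
    if "i < m" "z \<in> H" for i z w
  proof -
    have z: "Re z > 0" "z \<noteq> 0" using that by (auto simp: H_def)
    then show "[:(of_real (s i))\<^sup>2 + z\<^sup>2, of_real (s i) * z:] \<noteq> 0" by (cases "s i = 0") auto
    assume eq: "w * (of_real (s i) * z) + ((of_real (s i))\<^sup>2 + z\<^sup>2) = 0"
    \<comment> \<open>For \<open>s i = 0\<close> the factor is the nonzero constant
      \<open>z\<^sup>2\<close>, which has no root.\<close>
    then have si: "s i > 0" using z s[OF that(1)] by (cases "s i = 0") auto
    then have "w = - (of_real (s i) / z + z / of_real (s i))"
      using eq z by (simp add: field_simps power2_eq_square add_eq_0_iff)
    moreover have "Re (of_real (s i) / z) > 0"
      using si z by (simp add: Re_divide' complex_neq_0 cmod_power2 divide_pos_pos)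
    moreover have "Re (z / of_real (s i)) > 0" using si z by simp
    ultimately show "Re w < 0" by simp
  qed
  have G_root: "Re (1 * w) < 0" if "z \<in> H" "poly (G z) w = 0" for z w
    using that factor_root by (auto simp: G_def poly_prod algebra_simps)
  have G_ne: "G z \<noteq> 0" if "z \<in> H" for z
    using that factor_ne by (auto simp: G_def)
  \<comment> \<open>The degree of \<open>G z\<close> is the same for all \<open>z\<close> in
    \<open>H\<close>. Hence if \<open>p n\<close> annihilates a single \<open>G z0\<close>, its
    coefficients up to that degree vanish, and \<open>F n\<close> is zero on all of
    \<open>H\<close>.\<close>
  have deg: "degree (G z) = (\<Sum>i<m. if s i = 0 then 0 else 1)" if "z \<in> H" for z
  proof -
    have "z \<noteq> 0" using that by (auto simp: H_def)
    have "degree (G z) = (\<Sum>i<m. degree [:(of_real (s i))\<^sup>2 + z\<^sup>2, of_real (s i) * z:])"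
      unfolding G_def by (rule degree_prod_sum_eq) (use that factor_ne in auto)
    then show ?thesis using \<open>z \<noteq> 0\<close> by (auto intro!: sum.cong)
  qed
  define F where "F n z = (\<Sum>k\<le>m. fact k * coeff (p n) k * coeff (G z) k)" for n z
  have F: "F n z = poly (diff_op (p n) (G z)) 0" for n z
    unfolding F_def by (rule poly_diff_op_0[symmetric]) (use deg_le in auto)
  have "(\<forall>z\<in>H. (\<Sum>k\<le>m. gamma_seq \<mu> k * coeff (G z) k) \<noteq> 0) \<or>
      (\<forall>z\<in>H. (\<Sum>k\<le>m. gamma_seq \<mu> k * coeff (G z) k) = 0)"
  proof (rule Hurwitz_finite_sum[OF H(1,2) _ lim])
    show "(\<lambda>z. coeff (G z) k) holomorphic_on H" for k
      unfolding G_def by (intro coeff_holomorphic_linear_factors holomorphic_intros)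
    fix n
    show "(\<forall>z\<in>H. (\<Sum>k\<le>m. fact k * coeff (p n) k * coeff (G z) k) \<noteq> 0) \<or>
        (\<forall>z\<in>H. (\<Sum>k\<le>m. fact k * coeff (p n) k * coeff (G z) k) = 0)"
      unfolding F_def[symmetric]
    proof (cases "\<exists>z\<in>H. diff_op (p n) (G z) = 0")
      case True
      then obtain z0 where z0: "z0 \<in> H" "diff_op (p n) (G z0) = 0" by blast
      have "coeff (p n) k = 0" if "k \<le> degree (G z0)" for k
        using z0 that G_ne by (intro diff_op_eq_0D) auto
      then have "fact k * coeff (p n) k * coeff (G z) k = 0" if "z \<in> H" for z k
        using that z0(1) by (cases "k \<le> degree (G z)") (auto simp: deg coeff_eq_0)
      then have "F n z = 0" if "z \<in> H" for z
        unfolding F_def using that by (intro sum.neutral ballI)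
      then show "(\<forall>z\<in>H. F n z \<noteq> 0) \<or> (\<forall>z\<in>H. F n z = 0)" by blast
    next
      case False
      have "poly (diff_op (p n) (G z)) 0 \<noteq> 0" if "z \<in> H" for z
        by (rule diff_op_halfplane[where c = 1 and b = 0]) (use that p G_root False in auto)
      then show "(\<forall>z\<in>H. F n z \<noteq> 0) \<or> (\<forall>z\<in>H. F n z = 0)" by (simp add: F)
    qed
  qed
  moreover have "poly (T_poly \<mu> P) z = (\<Sum>k\<le>m. gamma_seq \<mu> k * coeff (G z) k)" for z
    unfolding P_def poly_T_poly_linear_factors G_def[symmetric]
    by (rule umbral_eval_altdef[OF deg_le])
  ultimately have "(\<forall>z\<in>H. poly (T_poly \<mu> P) z \<noteq> 0) \<or> (\<forall>z\<in>H. poly (T_poly \<mu> P) z = 0)"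
    by simp
  then show ?thesis
    using poly_eq_0_if_zero_on_open[OF H(1,3)]
    by (auto simp: weakly_Hurwitz_stable_def H_def)
qed

section \<open>Jensen polynomials and the Laguerre-Polya class\<close>

definition Jensen_poly :: "(nat \<Rightarrow> complex) \<Rightarrow> nat \<Rightarrow> complex poly" where
  "Jensen_poly a n = (\<Sum>k\<le>n. monom (of_nat (n choose k) * fact k * a k / of_nat n ^ k) k)"

lemma coeff_Jensen_poly:
  "coeff (Jensen_poly a n) k = (if k \<le> n then of_nat (n choose k) * fact k * a k / of_nat n ^ k else 0)"
  by (simp add: Jensen_poly_def coeff_sum)

lemma poly_Jensen_poly:
  "poly (Jensen_poly a n) z = (\<Sum>k\<le>n. a k * (of_nat (n choose k) * fact k * (z / of_nat n) ^ k))"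
  by (simp add: Jensen_poly_def poly_sum poly_monom power_divide mult_ac)

text \<open>For \<open>k \<le> n\<close> the factor of \<open>a k\<close> is the product of
  \<open>1 - i / n\<close> over \<open>i < k\<close>; the scaling by \<open>n ^ k\<close> in
  \<open>Jensen_poly\<close> is made for this limit.\<close>

lemma coeff_Jensen_poly_tendsto: "(\<lambda>n. coeff (Jensen_poly a n) k) \<longlonglongrightarrow> a k"
proof -
  have "(\<lambda>n. real (n choose k) * fact k / real n ^ k) \<longlonglongrightarrow> 1"
  proof (induction k)
    case (Suc k)
    have "(\<lambda>n. real (n choose k) * fact k / real n ^ k * (1 - real k / real n)) \<longlonglongrightarrow> 1 * (1 - 0)"
      by (intro tendsto_intros Suc.IH lim_const_over_n)
    moreover have "eventually (\<lambda>n. real (n choose k) * fact k / real n ^ k * (1 - real k / real n)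
        = real (n choose Suc k) * fact (Suc k) / real n ^ Suc k) sequentially"
      using eventually_gt_at_top[of k]
    proof eventually_elim
      case (elim n)
      have "real (Suc k * (n choose Suc k)) = real ((n - k) * (n choose k))"
        by (metis binomial_absorb_comp binomial_absorption)
      then have "real (Suc k) * real (n choose Suc k) = real (n - k) * real (n choose k)"
        by (simp only: of_nat_mult)
      then have "real (Suc k) * real (n choose Suc k) = (real n - real k) * real (n choose k)"
        using elim by (simp only: of_nat_diff less_imp_le)
      then have "real (n choose Suc k) * fact (Suc k) = (real n - real k) * real (n choose k) * fact k"
        by (simp add: mult_ac flip: of_nat_Suc)
      then show ?case using elim by (simp add: field_simps del: fact_Suc)
    qed
    ultimately show ?case by (auto dest: Lim_transform_eventually)
  qed simp
  then have "(\<lambda>n. complex_of_real (real (n choose k) * fact k / real n ^ k) * a k) \<longlonglongrightarrow> of_real 1 * a k"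
    by (intro tendsto_intros)
  moreover have "eventually (\<lambda>n. complex_of_real (real (n choose k) * fact k / real n ^ k) * a k
      = coeff (Jensen_poly a n) k) sequentially"
    using eventually_ge_at_top[of k] by eventually_elim (simp add: coeff_Jensen_poly)
  ultimately show ?thesis by (auto dest: Lim_transform_eventually)
qed

text \<open>With \<open>y = n / z\<close>, the \<open>n\<close>-th Jensen polynomial of \<open>p\<close> at \<open>z\<close> is \<open>y^(-n)\<close> times the value at
  \<open>y\<close> of the differential operator \<open>p\<close> applied to the \<open>n\<close>-th power.\<close>
lemma poly_diff_op_monom:
  assumes "z \<noteq> 0" "n > 0"
  shows "poly (diff_op p (monom 1 n)) (of_nat n / z) =
    (of_nat n / z) ^ n * poly (Jensen_poly (coeff p) n) z"
proof -
  let ?y = "of_nat n / z :: complex"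
  have y: "?y \<noteq> 0" using assms by simp
  have term_eq: "poly (smult (coeff p k) ((pderiv ^^ k) (monom 1 n))) ?y
      = (if k \<le> n then ?y ^ n * (coeff p k * (of_nat (n choose k) * fact k * (z / of_nat n) ^ k)) else 0)" for k
  proof (cases "k \<le> n")
    case True
    have "(pderiv ^^ k) (monom (1 :: complex) n) = monom (fact n / fact (n - k)) (n - k)"
      using True by (intro poly_eqI) (auto simp: coeff_higher_pderiv_fact coeff_monom)
    moreover have "?y ^ (n - k) = ?y ^ n * (z / of_nat n) ^ k"
      using True assms by (simp add: power_diff y power_divide field_simps)
    moreover have "fact n / fact (n - k) = of_nat (n choose k) * (fact k :: complex)"
      using True by (simp add: binomial_fact)
    ultimately show ?thesis using True by (simp add: poly_monom)
  next
    case False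
    then have "(pderiv ^^ k) (monom (1 :: complex) n) = 0"
      by (intro poly_eqI) (auto simp: coeff_higher_pderiv_fact coeff_monom)
    then show ?thesis using False by simp
  qed
  let ?N = "max n (degree p)"
  have "poly (diff_op p (monom 1 n)) ?y = (\<Sum>k\<le>?N. poly (smult (coeff p k) ((pderiv ^^ k) (monom 1 n))) ?y)"
    by (subst diff_op_altdef[where N = ?N]) (simp_all add: poly_sum)
  also have "\<dots> = (\<Sum>k\<le>n. ?y ^ n * (coeff p k * (of_nat (n choose k) * fact k * (z / of_nat n) ^ k)))"
    unfolding term_eq by (rule sum.mono_neutral_cong_right) auto
  finally show ?thesis by (simp add: poly_Jensen_poly sum_distrib_left)
qed

text \<open>The values \<open>\<i>\<close> and \<open>- \<i>\<close> of \<open>c\<close> stand for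
  the lower and the upper half-plane. For an approximant \<open>p m\<close> with real roots,
  \<open>poly_diff_op_monom\<close> reduces the claim to the roots of
  \<open>diff_op (p m) (monom 1 n)\<close>, and Hurwitz's theorem passes to
  \<open>f\<close>.\<close>

lemma Jensen_poly_LP_halfplane:
  assumes f: "f \<in> LP_class" and c: "c = \<i> \<or> c = - \<i>" and "n > 0"
  defines "J \<equiv> Jensen_poly (fps_nth (fps_expansion f 0)) n"
  shows "J = 0 \<or> (\<forall>z. Re (c * z) > 0 \<longrightarrow> poly J z \<noteq> 0)"
proof -
  obtain p where real_roots: "\<And>n z. poly (p n) z = 0 \<Longrightarrow> z \<in> \<real>"
    and lim: "locally_uniform_poly_limit p f"
    using f by (auto simp: LP_class_def)
  define S where "S = {z. Re (c * z) > 0}"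
  have S: "open S" "connected S" "1 / c \<in> S"
    unfolding S_def by (rule open_connected_halfplane; use c in auto)+
  have "(\<forall>z\<in>S. poly J z \<noteq> 0) \<or> (\<forall>z\<in>S. poly J z = 0)"
    unfolding J_def poly_Jensen_poly
  proof (rule Hurwitz_finite_sum[OF S(1,2) _ coeff_tendsto_fps_expansion[OF lim]])
    show "(\<lambda>z. of_nat (n choose k) * fact k * (z / of_nat n) ^ k) holomorphic_on S" for k
      using \<open>n > 0\<close> by (intro holomorphic_intros) auto
    fix m
    let ?D = "diff_op (p m) (monom 1 n)"
    show "(\<forall>z\<in>S. (\<Sum>k\<le>n. coeff (p m) k * (of_nat (n choose k) * fact k * (z / of_nat n) ^ k)) \<noteq> 0) \<or>
        (\<forall>z\<in>S. (\<Sum>k\<le>n. coeff (p m) k * (of_nat (n choose k) * fact k * (z / of_nat n) ^ k)) = 0)"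
      unfolding poly_Jensen_poly[symmetric]
    proof (cases "?D = 0")
      case True
      then have "coeff (p m) k = 0" if "k \<le> n" for k
        using that by (intro diff_op_eq_0D[OF True]) (auto simp: degree_monom_eq)
      then have "Jensen_poly (coeff (p m)) n = 0"
        by (intro poly_eqI) (auto simp: coeff_Jensen_poly)
      then show "(\<forall>z\<in>S. poly (Jensen_poly (coeff (p m)) n) z \<noteq> 0) \<or>
          (\<forall>z\<in>S. poly (Jensen_poly (coeff (p m)) n) z = 0)" by simp
    next
      case False
      have "poly (Jensen_poly (coeff (p m)) n) z \<noteq> 0" if "z \<in> S" for z
      proof -
        have z: "z \<noteq> 0" "Re (c * z) > 0" using that by (auto simp: S_def)
        \<comment> \<open>Passing from \<open>z\<close> to \<open>n / z\<close> exchanges the upper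
          and lower half-planes, hence the sign change of \<open>c\<close>.\<close>
        have *: "Re (- c * (of_nat n / z)) > 0"
        proof -
          have "Im (of_nat n / z) = - (of_nat n * Im z / (cmod z)\<^sup>2)"
            by (simp add: Im_divide')
          moreover have "of_nat n / (cmod z)\<^sup>2 > 0" using z \<open>n > 0\<close> by simp
          then have "Im z > 0 \<Longrightarrow> of_nat n * Im z / (cmod z)\<^sup>2 > 0"
            "Im z < 0 \<Longrightarrow> of_nat n * Im z / (cmod z)\<^sup>2 < 0"
            by (simp_all add: divide_pos_pos divide_neg_pos mult_pos_neg \<open>n > 0\<close> z)
          moreover have "Re (- \<i> * w) = Im w" "Re (\<i> * w) = - Im w" "- (- \<i>) = \<i>" for w
            by simp_all
          ultimately show ?thesis using c z(2) by (elim disjE) (simp_all only:, simp_all)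
        qed
        \<comment> \<open>With \<open>b\<close> taken at the evaluation point, \<open>b > 0\<close>
          puts the root 0 of the monomial strictly on the other side.\<close>
        have "poly ?D (of_nat n / z) \<noteq> 0"
        proof (rule diff_op_halfplane[where c = "- c" and b = "Re (- c * (of_nat n / z))"])
          show "Re (w / - c) \<le> 0" if "poly (p m) w = 0" for w
            using real_roots[OF that] c by (auto simp: complex_is_Real_iff)
          show "Re (- c * w) < Re (- c * (of_nat n / z))" if "poly (monom 1 n) w = 0" for w
            using that * \<open>n > 0\<close> by (simp add: poly_monom)
        qed (use False in auto)
        then show ?thesis using z \<open>n > 0\<close> by (simp add: poly_diff_op_monom)
      qed
      then show "(\<forall>z\<in>S. poly (Jensen_poly (coeff (p m)) n) z \<noteq> 0) \<or>
          (\<forall>z\<in>S. poly (Jensen_poly (coeff (p m)) n) z = 0)" by blast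
    qed
  qed
  then show ?thesis
    using poly_eq_0_if_zero_on_open[OF S(1,3)] by (auto simp: S_def)
qed

text \<open>Both open half-planes being free of zeros, \<open>z\<close> is real; at a positive
  number all terms of \<open>J\<close> are nonnegative and the leading one is positive.\<close>

lemma Jensen_poly_LP_plus:
  assumes f: "f \<in> LP_plus" and "n > 0"
  defines "J \<equiv> Jensen_poly (fps_nth (fps_expansion f 0)) n"
  assumes "J \<noteq> 0" "poly J z = 0"
  shows "z \<in> \<real>\<^sub>\<le>\<^sub>0"
proof -
  have "f \<in> LP_class" and nonneg: "\<And>k. fps_nth (fps_expansion f 0) k \<in> \<real>\<^sub>\<ge>\<^sub>0"
    using f by (auto simp: LP_plus_def)
  have "\<not> Re (\<i> * z) > 0" "\<not> Re (- \<i> * z) > 0"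
    using Jensen_poly_LP_halfplane[OF \<open>f \<in> LP_class\<close> _ \<open>n > 0\<close>] assms(4,5) unfolding J_def by blast+
  then have "Im z = 0" by simp
  then have z: "z = of_real (Re z)" by (simp add: complex_eq_iff)
  moreover have "Re z \<le> 0"
  proof (rule ccontr)
    assume "\<not> Re z \<le> 0"
    then have pos: "Re z > 0" by simp
    define b where "b k = Re (coeff J k)" for k
    have b: "coeff J k = of_real (b k)" "b k \<ge> 0" for k
      using nonneg[of k] by (auto simp: b_def J_def coeff_Jensen_poly complex_nonneg_Reals_iff complex_eq_iff
         simp flip: of_nat_power)
    have "of_real (\<Sum>k\<le>degree J. b k * Re z ^ k) = poly J z"
      by (subst z) (simp add: poly_altdef b(1))
    then have "(\<Sum>k\<le>degree J. b k * Re z ^ k) = 0"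
      using assms(5) by (metis of_real_eq_0_iff)
    then have "b (degree J) * Re z ^ degree J = 0"
      using pos b(2) by (subst (asm) sum_nonneg_eq_0_iff) auto
    then have "lead_coeff J = 0" using pos b(1) by simp
    then show False using \<open>J \<noteq> 0\<close> by simp
  qed
  ultimately show ?thesis by (metis complex_nonpos_Reals_iff Re_complex_of_real Im_complex_of_real)
qed

text \<open>The classical approximants \<open>(1 + z / n) ^ n\<close> of \<open>exp\<close>; taken
  as Jensen polynomials they inherit the coefficient limits.\<close>

definition exp_approx :: "nat \<Rightarrow> complex poly" where
  "exp_approx n = Jensen_poly (\<lambda>k. 1 / fact k) n"

lemma poly_exp_approx: "poly (exp_approx n) z = (1 + z / of_nat n) ^ n"
proof -
  have "poly (exp_approx n) z = (\<Sum>k\<le>n. of_nat (n choose k) * (z / of_nat n) ^ k * 1 ^ (n - k))"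
    by (simp add: exp_approx_def poly_Jensen_poly)
  also have "\<dots> = (z / of_nat n + 1) ^ n" by (rule binomial_ring[symmetric])
  finally show ?thesis by (simp add: add.commute)
qed

lemma exp_approx_root: "poly (exp_approx n) z = 0 \<Longrightarrow> z \<in> \<real>\<^sub>\<le>\<^sub>0"
proof -
  assume "poly (exp_approx n) z = 0"
  then have "n \<noteq> 0" "z / of_nat n = - 1"
    by (auto simp: poly_exp_approx add_eq_0_iff minus_equation_iff[of 1] intro: Nat.gr0I)
  then have "z = - of_nat n" by (simp add: field_simps)
  then show ?thesis by (simp add: complex_nonpos_Reals_iff)
qed

lemma coeff_exp_approx_tendsto: "(\<lambda>n. coeff (exp_approx n) k) \<longlonglongrightarrow> fps_nth (fps_exp 1) k"
  using coeff_Jensen_poly_tendsto[of "\<lambda>k. 1 / fact k" k] by (simp add: exp_approx_def)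

lemma fps_expansion_eval_fps:
  assumes "fps_conv_radius F > 0"
  shows "fps_expansion (eval_fps F) 0 = (F :: complex fps)"
  using eval_fps_has_fps_expansion[OF assms] by (rule fps_expansion_eqI)

text \<open>The approximants have no roots other than \<open>- n\<close>, so they are both
  real-rooted and Hurwitz stable; the latter upgrades their coefficientwise convergence to a locally
  uniform one.\<close>

lemma exp_in_LP_plus: "exp \<in> LP_plus"
proof -
  have exp_eq: "eval_fps (fps_exp 1) = (exp :: complex \<Rightarrow> complex)" by (simp add: fun_eq_iff)
  have "weakly_Hurwitz_stable (exp_approx n)" for n
    using exp_approx_root[of n] by (force simp: weakly_Hurwitz_stable_def complex_nonpos_Reals_iff)
  moreover have "fps_exp (1 :: complex) \<noteq> 0"
    using fps_nonzeroI[of "fps_exp (1 :: complex)" 0] by simp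
  ultimately have "locally_uniform_poly_limit exp_approx exp"
    using weakly_Hurwitz_stable_coeff_limit(2)[of exp_approx "fps_exp 1", OF _ coeff_exp_approx_tendsto]
    by (simp add: exp_eq)
  moreover have "coeff (exp_approx n) k \<in> \<real>" for n k
    by (auto simp: exp_approx_def coeff_Jensen_poly intro!: Reals_divide Reals_mult Reals_power)
  moreover have "z \<in> \<real>" if "poly (exp_approx n) z = 0" for n z
    using exp_approx_root[OF that] by (auto simp: complex_nonpos_Reals_iff complex_is_Real_iff)
  moreover have "exp holomorphic_on (UNIV :: complex set)" by (intro holomorphic_intros)
  ultimately have "exp \<in> LP_class" unfolding LP_class_def by blast
  moreover have "fps_expansion exp 0 = fps_exp (1 :: complex)"
    using fps_expansion_eval_fps[of "fps_exp 1"] by (simp add: exp_eq)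
  moreover have "fps_nth (fps_exp (1 :: complex)) n \<in> \<real>\<^sub>\<ge>\<^sub>0" for n
  proof -
    have "fps_nth (fps_exp (1 :: complex)) n = of_real (1 / fact n)" by simp
    then show ?thesis by (simp only: nonneg_Reals_of_real_iff) simp
  qed
  ultimately show ?thesis by (simp add: LP_plus_def)
qed

lemma T_fps_coeff_limit:
  assumes T: "\<And>n. T_poly \<mu> (p n) = 0 \<or> weakly_Hurwitz_stable (T_poly \<mu> (p n))"
    and lim: "\<And>k. (\<lambda>n. coeff (p n) k) \<longlonglongrightarrow> fps_nth F k"
  shows "T_fps \<mu> F \<in> entire_fps (Hurwitz_class \<union> {\<lambda>_. 0})"
proof (rule entire_fps_Hurwitz_coeff_limit[OF T])
  show "(\<lambda>n. coeff (T_poly \<mu> (p n)) k) \<longlonglongrightarrow> fps_nth (T_fps \<mu> F) k" for k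
    unfolding coeff_T_poly T_fps_def fps_nth_Abs_fps T_coeff_altdef
    by (intro tendsto_intros lim)
qed

theorem theorem5p4:
  fixes \<mu> :: "nat \<Rightarrow> complex"
  defines "cond_i \<equiv> (\<forall>P. (\<forall>z. poly P z = 0 \<longrightarrow> z \<in> \<real>\<^sub>\<le>\<^sub>0) \<longrightarrow>
                        T_poly \<mu> P = 0 \<or> weakly_Hurwitz_stable (T_poly \<mu> P))"
    and "cond_ii \<equiv> T_exp \<mu> \<in> entire_fps (Hurwitz_class \<union> {\<lambda>_. 0})"
    and "cond_iii \<equiv> (\<lambda>f. T_fps \<mu> (fps_expansion f 0)) ` LP_plus
                      \<subseteq> entire_fps (Hurwitz_class \<union> {\<lambda>_. 0})"
  shows "(cond_i \<longleftrightarrow> cond_ii) \<and> (cond_ii \<longleftrightarrow> cond_iii)"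
proof -
  have "cond_iii" if "cond_i"
    unfolding cond_iii_def
  proof safe
    fix f assume f: "f \<in> LP_plus"
    \<comment> \<open>The index starts at 1 because \<open>Jensen_poly_LP_plus\<close> assumes
      \<open>n > 0\<close>.\<close>
    let ?J = "\<lambda>n. Jensen_poly (fps_nth (fps_expansion f 0)) (Suc n)"
    show "T_fps \<mu> (fps_expansion f 0) \<in> entire_fps (Hurwitz_class \<union> {\<lambda>_. 0})"
    proof (rule T_fps_coeff_limit)
      fix n
      show "T_poly \<mu> (?J n) = 0 \<or> weakly_Hurwitz_stable (T_poly \<mu> (?J n))"
      proof (cases "?J n = 0")
        case True
        \<comment> \<open>The zero polynomial has every number as a root, so \<open>cond_i\<close>
          does not cover it.\<close>
        then show ?thesis using T_poly_smult[of \<mu> 0 0] by simp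
      next
        case False
        with \<open>cond_i\<close> Jensen_poly_LP_plus[OF f] show ?thesis
          unfolding cond_i_def by blast
      qed
      show "(\<lambda>n. coeff (?J n) k) \<longlonglongrightarrow> fps_nth (fps_expansion f 0) k" for k
        using coeff_Jensen_poly_tendsto by (rule LIMSEQ_Suc)
    qed
  qed
  moreover have "cond_ii" if "cond_iii"
  proof -
    have "fps_expansion exp 0 = fps_exp (1 :: complex)"
      using fps_expansion_eval_fps[of "fps_exp 1"] by (simp add: eval_fps_exp[abs_def])
    then show ?thesis
      using that exp_in_LP_plus unfolding cond_ii_def cond_iii_def T_exp_eq
      by (metis image_subset_iff)
  qed
  moreover have "cond_i" if "cond_ii"
    unfolding cond_i_def
  proof (intro allI impI)
    fix P :: "complex poly" assume "\<forall>z. poly P z = 0 \<longrightarrow> z \<in> \<real>\<^sub>\<le>\<^sub>0"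
    then obtain c m and s :: "nat \<Rightarrow> real" where P: "P = smult c (\<Prod>i<m. [:complex_of_real (s i), 1:])"
      and s: "\<And>i. i < m \<Longrightarrow> s i \<ge> 0"
      using nonpos_root_factors by metis
    let ?Q = "\<Prod>i<m. [:complex_of_real (s i), 1:]"
    define f where "f = eval_fps (T_exp \<mu>)"
    from that have "fps_conv_radius (T_exp \<mu>) = \<infinity>" and f: "f \<in> Hurwitz_class \<union> {\<lambda>_. 0}"
      by (auto simp: cond_ii_def entire_fps_def f_def)
    then have expand: "fps_expansion f 0 = T_exp \<mu>"
      unfolding f_def by (intro fps_expansion_eval_fps) simp
    obtain p where p: "\<And>n z. poly (p n) z = 0 \<Longrightarrow> Re z \<le> 0"
      and lim: "\<And>k. (\<lambda>n. coeff (p n) k) \<longlonglongrightarrow> fps_nth (T_exp \<mu>) k"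
    proof (cases "f \<in> Hurwitz_class")
      case True
      with that coeff_tendsto_fps_expansion[of _ f] show thesis
        unfolding expand Hurwitz_class_def by blast
    next
      case False
      then have "f = (\<lambda>_. 0)" using f by auto
      then have "fps_expansion f 0 = 0" by (intro fps_expansion_eqI) simp
      then have "T_exp \<mu> = 0" using expand by simp
      \<comment> \<open>The zero function is the limit of nonzero constants, which have no roots, so
        it needs no separate argument below.\<close>
      moreover have "(\<lambda>n. coeff [:1 / complex_of_nat (Suc n):] k) \<longlonglongrightarrow> 0" for k
        using LIMSEQ_Suc[OF lim_1_over_n[where 'a = complex]]
        by (cases k) auto
      ultimately show thesis
        by (intro that[of "\<lambda>n. [:1 / of_nat (Suc n):]"]) (auto simp del: of_nat_Suc)
    qed
    have "(\<lambda>n. fact k * coeff (p n) k) \<longlonglongrightarrow> fact k * fps_nth (T_exp \<mu>) k" for k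
      by (intro tendsto_intros lim)
    then have gamma: "(\<lambda>n. fact k * coeff (p n) k) \<longlonglongrightarrow> gamma_seq \<mu> k" for k
      by (simp add: T_exp_def)
    have "T_poly \<mu> ?Q = 0 \<or> weakly_Hurwitz_stable (T_poly \<mu> ?Q)"
      by (rule T_poly_linear_factors_stable[of p]) (use p gamma s in auto)
    then show "T_poly \<mu> P = 0 \<or> weakly_Hurwitz_stable (T_poly \<mu> P)"
      unfolding P T_poly_smult by (cases "c = 0") (auto simp: weakly_Hurwitz_stable_def)
  qed
  ultimately show ?thesis by blast
qed

end
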